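(* Let $f(x)=|x-\xi|^{\alpha}g(x)$ on $[-1,1]$, where $\xi\in(-1,1)$, $\alpha>0$ is not an even integer, $g\in C^{\infty}([-1,1])$ and $g(\xi)\neq0$. Let $\mathcal{P}_n$ be the Legendre projection of degree $n$ of $f$. Then, as $n\to\infty$, for each fixed $x\in[-1,1]$, $$|f(x)-\mathcal{P}_n(x)|=\begin{cases}O(n^{-\alpha}), & \text{if } x=\xi,\\ O(n^{-\alpha-1/2}), & \text{if } x=\pm1,\\ O(n^{-\alpha-1}), & \text{otherwise}.\end{cases}$$
   Context: The Legendre projection of degree $n$ of $f$ is $\mathcal{P}_n(x)=\sum_{k=0}^{n}a_k^{L}P_k(x)$ with $a_k^{L}=\frac{2k+1}{2}\int_{-1}^{1}f(x)P_k(x)\,dx$, where $P_k$ is the Legendre polynomial of degree $k$ (normalized by $P_k(1)=1$). The estimates are pointwise: the implied constants may depend on $x$ (and on $f$) but not on $n$. *)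

theory Defs
  imports
    "HOL-Analysis.Analysis"
    "HOL-Computational_Algebra.Polynomial"
    "HOL-Library.Landau_Symbols"
begin

text \<open>Rodrigues' formula: \<open>P\<^sub>n(x) = 1 / (2\<^sup>n n!) (d/dx)\<^sup>n (x\<^sup>2 - 1)\<^sup>n\<close>.\<close>

definition legendre_poly :: "nat \<Rightarrow> real poly" where
  "legendre_poly n = smult (1 / (2 ^ n * fact n)) ((pderiv ^^ n) ([:-1, 0, 1:] ^ n))"

definition legendre_coeff :: "(real \<Rightarrow> real) \<Rightarrow> nat \<Rightarrow> real" where
  "legendre_coeff f k =
     (2 * real k + 1) / 2 * integral {-1..1} (\<lambda>x. f x * poly (legendre_poly k) x)"

definition legendre_projection :: "(real \<Rightarrow> real) \<Rightarrow> nat \<Rightarrow> real \<Rightarrow> real" where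
  "legendre_projection f n x = (\<Sum>k\<le>n. legendre_coeff f k * poly (legendre_poly k) x)"

text \<open>
  \<open>C\<^sup>\<infinity>\<close> on a set without isolated points, such as a compact interval: derivatives of all
  orders exist on \<open>S\<close>, taken within \<open>S\<close>, hence one-sided at the end points of an interval.
  \<open>G k\<close> is the derivative of order \<open>k\<close>. Values of \<open>g\<close> outside \<open>S\<close> are irrelevant.
\<close>

definition smooth_on :: "real set \<Rightarrow> (real \<Rightarrow> real) \<Rightarrow> bool" where
  "smooth_on S g \<longleftrightarrow>
     (\<exists>G :: nat \<Rightarrow> real \<Rightarrow> real. (\<forall>x\<in>S. G 0 x = g x) \<and>
        (\<forall>k. \<forall>x\<in>S. (G k has_real_derivative G (Suc k) x) (at x within S)))"

lemma poly_higher_pderiv_linear_power_mult: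
  fixes q :: "real poly"
  shows "poly ((pderiv ^^ n) ([:-a, 1:] ^ n * q)) a = fact n * poly q a"
proof (induction n arbitrary: q)
  case 0
  then show ?case by simp
next
  case (Suc n)
  have "pderiv ([:-a, 1:] ^ Suc n * q) =
      [:-a, 1:] ^ n * (smult (real (Suc n)) q + [:-a, 1:] * pderiv q)"
    by (simp only: pderiv_mult pderiv_power_Suc) (simp add: pderiv_pCons algebra_simps)
  then show ?case
    by (simp only: funpow_Suc_right o_def Suc.IH) (simp add: algebra_simps)
qed

lemma poly_legendre_poly_1 [simp]: "poly (legendre_poly n) 1 = 1"
proof -
  have "[:-1, 0, 1:] = [:-1, 1:] * ([:1, 1:] :: real poly)"
    by simp
  then have "([:-1, 0, 1:] :: real poly) ^ n = [:-1, 1:] ^ n * [:1, 1:] ^ n"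
    by (metis power_mult_distrib)
  then show ?thesis
    using poly_higher_pderiv_linear_power_mult[of n 1 "[:1, 1:] ^ n"]
    by (simp add: legendre_poly_def poly_power)
qed

end

theory Submission
  imports Defs
begin

text \<open>
  Write \<open>K\<^sub>n(x, t)\<close> for the kernel of the projection, which reproduces polynomials of degree at most
  \<open>n\<close>. Choose a polynomial \<open>p = c (t - \<xi>)\<^sup>N\<close> with \<open>p(x) = f(x)\<close> and \<open>N \<ge> \<alpha>\<close> (\<open>p = 0\<close> if \<open>x = \<xi>\<close>). The
  error is then minus the integral of \<open>(f - p) K\<^sub>n(x, \<cdot>)\<close>, and by the Christoffel--Darboux formula it equals,
  up to a factor of order \<open>n\<close>, a combination of \<open>P\<^sub>n\<^sub>+\<^sub>1(x) \<integral> h P\<^sub>n\<close> and \<open>P\<^sub>n(x) \<integral> h P\<^sub>n\<^sub>+\<^sub>1\<close> with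
  \<open>h(t) = (f(t) - p(t)) / (x - t)\<close>. Off \<open>\<xi>\<close> this quotient is smooth, also at \<open>x\<close>, and its \<open>k\<close>-th derivative is
  \<open>O(\<bar>t - \<xi>\<bar>\<^sup>\<beta>\<^sup>-\<^sup>k)\<close>, where \<open>\<beta> = \<alpha>\<close>, except that \<open>\<beta> = \<alpha> - 1\<close> if \<open>x = \<xi>\<close>.

  The integrals are \<open>O(n\<^sup>-\<^sup>\<beta>\<^sup>-\<^sup>3\<^sup>/\<^sup>2)\<close>: within \<open>1/n\<close> of \<open>\<xi>\<close> use \<open>P\<^sub>n = O(n\<^sup>-\<^sup>1\<^sup>/\<^sup>2)\<close>, and outside integrate by parts
  often enough, using that the iterated primitives of \<open>P\<^sub>n\<close> are combinations of neighbouring Legendre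
  polynomials, gain a factor \<open>1/n\<close> each time, and vanish at the end points. The three rates come from
  the size of \<open>P\<^sub>n(x)\<close>, which is \<open>O(n\<^sup>-\<^sup>1\<^sup>/\<^sup>2)\<close> inside the interval and \<open>1\<close> in absolute value at \<open>\<plusminus>1\<close>.
\<close>

section \<open>Identities for Legendre polynomials\<close>

text \<open>Leibniz rule: the second derivative of X vanishes, so only two terms survive.\<close>

lemma higher_pderiv_X_mult:
  "(pderiv ^^ Suc m) ([:0, 1:] * p) =
     [:0, 1:] * (pderiv ^^ Suc m) p + smult (of_nat (Suc m)) ((pderiv ^^ m) p)"
  for p :: "real poly"
proof (induction m)
  case 0
  then show ?case by (simp add: pderiv_mult pderiv_pCons)
next
  case (Suc m)
  have "(pderiv ^^ Suc (Suc m)) ([:0, 1:] * p) = pderiv ((pderiv ^^ Suc m) ([:0, 1:] * p))"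
    by simp
  also have "\<dots> = pderiv ([:0, 1:] * (pderiv ^^ Suc m) p + smult (of_nat (Suc m)) ((pderiv ^^ m) p))"
    by (simp only: Suc.IH)
  also have "\<dots> = [:0, 1:] * (pderiv ^^ Suc (Suc m)) p + ((pderiv ^^ Suc m) p
      + smult (of_nat (Suc m)) ((pderiv ^^ Suc m) p))"
    by (simp only: pderiv_add pderiv_mult pderiv_smult funpow.simps o_def)
      (simp add: pderiv_pCons)
  also have "(pderiv ^^ Suc m) p + smult (of_nat (Suc m)) ((pderiv ^^ Suc m) p) =
      smult (of_nat (Suc (Suc m))) ((pderiv ^^ Suc m) p)"
    by (simp only: of_nat_Suc smult_add_left smult_1_left add.commute)
  finally show ?case .
qed

lemma pderiv_quadratic_power:
  "pderiv ([:-1, 0, 1:] ^ Suc n) = smult (2 * real (Suc n)) ([:0, 1:] * [:-1, 0, 1:] ^ n)"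
  by (simp only: pderiv_power_Suc) (simp add: pderiv_pCons algebra_simps)

text \<open>With u = X^2 - 1, differentiating X u^(n+1) leaves X^2 u^n; writing X^2 = u + 1 returns
  to powers of u, which Rodrigues' formula turns into Legendre polynomials.\<close>

lemma pderiv2_quadratic_power:
  "pderiv (pderiv ([:-1, 0, 1:] ^ Suc (Suc n))) =
     smult (2 * real (Suc (Suc n))) (smult (2 * real n + 3) ([:-1, 0, 1:] ^ Suc n)
       + smult (2 * real (Suc n)) ([:-1, 0, 1:] ^ n))"
proof -
  have "pderiv ([:0, 1:] * [:-1, 0, 1:] ^ Suc n) =
      smult (2 * real n + 3) ([:-1, 0, 1:] ^ Suc n) + smult (2 * real (Suc n)) ([:-1, 0, 1:] ^ n)"
    unfolding pderiv_mult pderiv_quadratic_power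
    by (intro poly_eq_poly_eq_iff[THEN iffD1] ext) (simp add: pderiv_pCons algebra_simps)
  then show ?thesis
    by (simp only: pderiv_quadratic_power pderiv_smult)
qed

lemma legendre_poly_0 [simp]: "legendre_poly 0 = 1"
  by (simp add: legendre_poly_def)

lemma legendre_poly_1 [simp]: "legendre_poly (Suc 0) = [:0, 1:]"
  by (simp add: legendre_poly_def pderiv_pCons)

text \<open>One derivative in Rodrigues' formula is applied first, to (X^2 - 1)^(n+1). It leaves a
  factor X, which the Leibniz rule moves outside.\<close>

lemma pderiv_legendre_poly_Suc:
  "pderiv (legendre_poly (Suc n)) =
     [:0, 1:] * pderiv (legendre_poly n) + smult (real (Suc n)) (legendre_poly n)"
proof -
  let ?u = "[:-1, 0, 1 :: real:]" and ?c = "1 / (2 ^ n * fact n) :: real"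
  have "pderiv (legendre_poly (Suc n)) =
      smult (1 / (2 ^ Suc n * fact (Suc n))) ((pderiv ^^ Suc n) (pderiv (?u ^ Suc n)))"
    by (simp only: legendre_poly_def pderiv_smult funpow_Suc_right[of "Suc n"] o_def)
       (metis comp_apply funpow.simps(2) funpow_Suc_right)
  also have "\<dots> = smult (1 / (2 ^ Suc n * fact (Suc n)) * (2 * real (Suc n)))
      ((pderiv ^^ Suc n) ([:0, 1:] * ?u ^ n))"
    by (simp only: pderiv_quadratic_power higher_pderiv_smult smult_smult)
  also have "1 / (2 ^ Suc n * fact (Suc n)) * (2 * real (Suc n)) = ?c"
    by (simp del: of_nat_Suc)
  also have "smult ?c ((pderiv ^^ Suc n) ([:0, 1:] * ?u ^ n)) =
      [:0, 1:] * pderiv (legendre_poly n) + smult (real (Suc n)) (legendre_poly n)"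
    unfolding higher_pderiv_X_mult legendre_poly_def pderiv_smult
    by (simp add: smult_add_right mult.commute)
  finally show ?thesis .
qed

text \<open>Here two derivatives are applied first. The identity makes a primitive of P_(n+1) a
  combination of its two neighbours.\<close>

lemma pderiv_legendre_poly_Suc_Suc:
  "pderiv (legendre_poly (Suc (Suc n))) =
     smult (2 * real n + 3) (legendre_poly (Suc n)) + pderiv (legendre_poly n)"
proof -
  let ?u = "[:-1, 0, 1 :: real:]"
  let ?c = "1 / (2 ^ Suc n * fact (Suc n)) :: real"
  have "pderiv (legendre_poly (Suc (Suc n))) =
      smult (1 / (2 ^ Suc (Suc n) * fact (Suc (Suc n))))
        ((pderiv ^^ Suc n) (pderiv (pderiv (?u ^ Suc (Suc n)))))"
    by (simp only: legendre_poly_def pderiv_smult)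
       (metis comp_apply funpow.simps(2) funpow_Suc_right)
  also have "\<dots> = smult (1 / (2 ^ Suc (Suc n) * fact (Suc (Suc n))) * (2 * real (Suc (Suc n))))
      (smult (2 * real n + 3) ((pderiv ^^ Suc n) (?u ^ Suc n))
       + smult (2 * real (Suc n)) ((pderiv ^^ Suc n) (?u ^ n)))"
    by (simp only: pderiv2_quadratic_power higher_pderiv_smult higher_pderiv_add smult_smult)
  also have "1 / (2 ^ Suc (Suc n) * fact (Suc (Suc n))) * (2 * real (Suc (Suc n))) = ?c"
    by (simp del: of_nat_Suc)
  also have "smult ?c (smult (2 * real n + 3) ((pderiv ^^ Suc n) (?u ^ Suc n))
       + smult (2 * real (Suc n)) ((pderiv ^^ Suc n) (?u ^ n))) =
       smult (2 * real n + 3) (legendre_poly (Suc n)) +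
       smult (?c * (2 * real (Suc n))) ((pderiv ^^ Suc n) (?u ^ n))"
    unfolding legendre_poly_def smult_add_right smult_smult by (simp only: mult.commute)
  also have "?c * (2 * real (Suc n)) = 1 / (2 ^ n * fact n)"
    by (simp del: of_nat_Suc)
  finally show ?thesis
    unfolding legendre_poly_def by (simp add: pderiv_smult)
qed

lemma legendre_deriv_diff:
  "poly (pderiv (legendre_poly n)) x =
     x * poly (pderiv (legendre_poly (Suc n))) x - real (Suc n) * poly (legendre_poly (Suc n)) x"
proof -
  have "poly (pderiv (legendre_poly (Suc (Suc n)))) x =
      x * poly (pderiv (legendre_poly (Suc n))) x + (real n + 2) * poly (legendre_poly (Suc n)) x"
    by (subst pderiv_legendre_poly_Suc) (simp add: algebra_simps)
  moreover have "poly (pderiv (legendre_poly (Suc (Suc n)))) x =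
      (2 * real n + 3) * poly (legendre_poly (Suc n)) x + poly (pderiv (legendre_poly n)) x"
    by (simp add: pderiv_legendre_poly_Suc_Suc)
  ultimately show ?thesis by (simp add: algebra_simps)
qed

lemma legendre_deriv_Suc:
  "poly (pderiv (legendre_poly (Suc n))) x =
     x * poly (pderiv (legendre_poly n)) x + real (Suc n) * poly (legendre_poly n) x"
  by (simp add: pderiv_legendre_poly_Suc)

lemma legendre_deriv_up:
  "(1 - x\<^sup>2) * poly (pderiv (legendre_poly n)) x =
     real (Suc n) * (x * poly (legendre_poly n) x - poly (legendre_poly (Suc n)) x)"
  using legendre_deriv_diff[of n x] legendre_deriv_Suc[of n x] by algebra

lemma legendre_deriv_down:
  "(1 - x\<^sup>2) * poly (pderiv (legendre_poly (Suc n))) x =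
     real (Suc n) * (poly (legendre_poly n) x - x * poly (legendre_poly (Suc n)) x)"
  using legendre_deriv_diff[of n x] legendre_deriv_Suc[of n x] by algebra

text \<open>The two formulas above, at \<open>Suc n\<close> and at \<open>n\<close>, both express (1
  - x^2) P'_(n+1); equating them removes the derivative.\<close>

lemma legendre_recurrence:
  "real (Suc (Suc n)) * poly (legendre_poly (Suc (Suc n))) x =
     (2 * real n + 3) * x * poly (legendre_poly (Suc n)) x - real (Suc n) * poly (legendre_poly n) x"
  using legendre_deriv_up[of x "Suc n"] legendre_deriv_down[of x n]
  by (simp add: algebra_simps)

text \<open>Differentiate \<open>legendre_deriv_up\<close> and replace P'_(n+1) by
  \<open>pderiv_legendre_poly_Suc\<close>.\<close>

lemma legendre_ode:
  "(1 - x\<^sup>2) * poly (pderiv (pderiv (legendre_poly n))) x =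
     2 * x * poly (pderiv (legendre_poly n)) x - real n * real (Suc n) * poly (legendre_poly n) x"
proof -
  have "[:1, 0, -1:] * pderiv (legendre_poly n) =
      smult (real (Suc n)) ([:0, 1:] * legendre_poly n - legendre_poly (Suc n))"
    using legendre_deriv_up[of _ n]
    by (intro poly_eq_poly_eq_iff[THEN iffD1] ext) (simp add: power2_eq_square algebra_simps)
  then have "poly (pderiv ([:1, 0, -1:] * pderiv (legendre_poly n))) x =
      poly (pderiv (smult (real (Suc n)) ([:0, 1:] * legendre_poly n - legendre_poly (Suc n)))) x"
    by simp
  then show ?thesis
    unfolding pderiv_mult pderiv_smult pderiv_diff pderiv_legendre_poly_Suc
    by (simp add: pderiv_pCons power2_eq_square algebra_simps)
qed

lemma legendre_poly_minus: "poly (legendre_poly n) (- x) = (-1) ^ n * poly (legendre_poly n) x"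
proof (induction n rule: induct_nat_012)
  case (ge2 n)
  have "real (Suc (Suc n)) * poly (legendre_poly (Suc (Suc n))) (-x) =
      (-1) ^ n * ((2 * real n + 3) * x * poly (legendre_poly (Suc n)) x
        - real (Suc n) * poly (legendre_poly n) x)"
    unfolding legendre_recurrence ge2 by (simp add: algebra_simps)
  also have "\<dots> = real (Suc (Suc n)) * ((-1) ^ Suc (Suc n) * poly (legendre_poly (Suc (Suc n))) x)"
    unfolding legendre_recurrence[symmetric] by simp
  finally have "real (Suc (Suc n)) * poly (legendre_poly (Suc (Suc n))) (-x) =
      real (Suc (Suc n)) * ((-1) ^ Suc (Suc n) * poly (legendre_poly (Suc (Suc n))) x)" .
  then show ?case by simp
qed simp_all

lemma poly_legendre_poly_neg_1: "poly (legendre_poly n) (- 1) = (-1) ^ n"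
  by (subst legendre_poly_minus) simp

section \<open>The kernel of the projection\<close>

definition legendre_kernel :: "nat \<Rightarrow> real \<Rightarrow> real \<Rightarrow> real" where
  "legendre_kernel n x t =
     (\<Sum>k\<le>n. (2 * real k + 1) / 2 * poly (legendre_poly k) x * poly (legendre_poly k) t)"

text \<open>A telescoping sum: by the recurrences at x and at t, x - t times the summand of index n
  + 1 is the difference of the right-hand sides for n + 1 and n.\<close>

lemma christoffel_darboux:
  "(x - t) * legendre_kernel n x t =
     real (Suc n) / 2 * (poly (legendre_poly (Suc n)) x * poly (legendre_poly n) t
       - poly (legendre_poly n) x * poly (legendre_poly (Suc n)) t)"
proof (induction n)
  case 0
  then show ?case by (simp add: legendre_kernel_def)
next
  case (Suc n)
  have "(x - t) * legendre_kernel (Suc n) x t =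
      (x - t) * legendre_kernel n x t +
      (x - t) * (2 * real n + 3) / 2 * poly (legendre_poly (Suc n)) x * poly (legendre_poly (Suc n)) t"
    by (simp add: legendre_kernel_def algebra_simps)
  with Suc show ?case
    using legendre_recurrence[of n x] legendre_recurrence[of n t]
    by simp algebra
qed

text \<open>Allows the part of the interval left of the singularity to be treated by
  reflection.\<close>

lemma legendre_kernel_minus: "legendre_kernel n x (- t) = legendre_kernel n (- x) t"
  by (simp add: legendre_kernel_def legendre_poly_minus mult_ac)

lemma continuous_on_legendre_kernel [continuous_intros]: "continuous_on S (legendre_kernel n x)"
  unfolding legendre_kernel_def by (intro continuous_intros)

section \<open>Bounds for Legendre polynomials and their primitives\<close>

lemma legendre_poly_0_squared_le: "(poly (legendre_poly n) 0)\<^sup>2 \<le> 1 / (real n + 1)"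
proof (induction n rule: induct_nat_012)
  case (ge2 n)
  have "poly (legendre_poly (Suc (Suc n))) 0 = - ((real n + 1) / (real n + 2)) * poly (legendre_poly n) 0"
    using legendre_recurrence[of n 0] by (simp add: field_simps)
  then have "(poly (legendre_poly (Suc (Suc n))) 0)\<^sup>2 =
      ((real n + 1) / (real n + 2))\<^sup>2 * (poly (legendre_poly n) 0)\<^sup>2"
    by (simp only: power_mult_distrib power2_minus)
  also have "\<dots> \<le> ((real n + 1) / (real n + 2))\<^sup>2 * (1 / (real n + 1))"
    by (intro mult_left_mono ge2) simp
  also have "\<dots> = (real n + 1) / (real n + 2)\<^sup>2"
    using of_nat_0_le_iff[of n] by (simp add: power2_eq_square)
  also have "\<dots> \<le> 1 / (real (Suc (Suc n)) + 1)"
  proof -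
    \<comment> \<open>The induction closes because (n + 1)(n + 3) = (n + 2)^2 - 1.\<close>
    have "(real n + 1) * (real n + 3) \<le> 1 * (real n + 2)\<^sup>2"
      by (simp add: power2_eq_square algebra_simps)
    then have "(real n + 1) / (real n + 2)\<^sup>2 \<le> 1 / (real n + 3)"
      by (intro mult_imp_div_pos_le) (simp_all add: pos_le_divide_eq)
    then show ?thesis by (simp add: add_ac)
  qed
  finally show ?case .
qed simp_all

text \<open>Sonin's function, scaled by n(n + 1).\<close>

definition legendre_energy :: "nat \<Rightarrow> real \<Rightarrow> real" where
  "legendre_energy n x = real n * real (Suc n) * (poly (legendre_poly n) x)\<^sup>2
     + (1 - x\<^sup>2) * (poly (pderiv (legendre_poly n)) x)\<^sup>2"

text \<open>By the differential equation the terms with P P' cancel, and the remaining multiples -2x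
  and 4x of P'^2 add up to 2x.\<close>

lemma DERIV_legendre_energy:
  "(legendre_energy n has_real_derivative 2 * x * (poly (pderiv (legendre_poly n)) x)\<^sup>2) (at x)"
proof -
  let ?P = "poly (legendre_poly n) x" and ?P' = "poly (pderiv (legendre_poly n)) x"
    and ?P'' = "poly (pderiv (pderiv (legendre_poly n))) x"
  have "(legendre_energy n has_real_derivative
      real n * real (Suc n) * (2 * ?P * ?P') + (- 2 * x * ?P'\<^sup>2 + (1 - x\<^sup>2) * (2 * ?P' * ?P''))) (at x)"
    unfolding legendre_energy_def
    by (auto intro!: derivative_eq_intros poly_DERIV simp del: of_nat_Suc)
  moreover have "real n * real (Suc n) * (2 * ?P * ?P') + (- 2 * x * ?P'\<^sup>2 + (1 - x\<^sup>2) * (2 * ?P' * ?P'')) =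
      2 * x * ?P'\<^sup>2"
    using legendre_ode[of x n] by algebra
  ultimately show ?thesis by (simp only:)
qed

text \<open>The energy increases on [0, 1]; at 1 its second term vanishes and P_n is 1.\<close>

lemma legendre_energy_le_1:
  assumes "x \<in> {0..1}"
  shows "legendre_energy n x \<le> real n * real (Suc n)"
proof -
  have "legendre_energy n x \<le> legendre_energy n 1"
  proof (rule DERIV_nonneg_imp_nondecreasing[of x 1 "legendre_energy n"])
    fix y assume "x \<le> y" "y \<le> 1"
    with assms show "\<exists>d. (legendre_energy n has_real_derivative d) (at y) \<and> 0 \<le> d"
      by (intro exI[of _ "2 * y * (poly (pderiv (legendre_poly n)) y)\<^sup>2"] conjI DERIV_legendre_energy) auto
  qed (use assms in auto)
  then show ?thesis by (simp add: legendre_energy_def)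
qed

text \<open>The weight reverses the monotonicity: the terms with P'^2 cancel in the derivative,
  which leaves a nonpositive multiple of P^2.\<close>

lemma weighted_legendre_energy_le:
  assumes "x \<in> {0..1}"
  shows "(1 - x\<^sup>2) * legendre_energy n x \<le> legendre_energy n 0"
proof -
  have "(1 - x\<^sup>2) * legendre_energy n x \<le> (1 - 0\<^sup>2) * legendre_energy n 0"
  proof (rule DERIV_nonpos_imp_nonincreasing[of 0 x "\<lambda>y. (1 - y\<^sup>2) * legendre_energy n y"])
    fix y assume y: "0 \<le> y" "y \<le> x"
    let ?d = "- (2 * y) * (real n * real (Suc n) * (poly (legendre_poly n) y)\<^sup>2)"
    have "((\<lambda>y. (1 - y\<^sup>2) * legendre_energy n y) has_real_derivative
        - (2 * y) * legendre_energy n y + (1 - y\<^sup>2) * (2 * y * (poly (pderiv (legendre_poly n)) y)\<^sup>2)) (at y)"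
      by (auto intro!: derivative_eq_intros DERIV_legendre_energy)
    moreover have "- (2 * y) * legendre_energy n y +
        (1 - y\<^sup>2) * (2 * y * (poly (pderiv (legendre_poly n)) y)\<^sup>2) = ?d"
      unfolding legendre_energy_def by algebra
    ultimately have "((\<lambda>y. (1 - y\<^sup>2) * legendre_energy n y) has_real_derivative ?d) (at y)"
      by simp
    moreover have "?d \<le> 0"
      using y by (simp add: mult_nonneg_nonneg)
    ultimately show "\<exists>d. ((\<lambda>y. (1 - y\<^sup>2) * legendre_energy n y) has_real_derivative d) (at y) \<and> d \<le> 0"
      by blast
  qed (use assms in auto)
  then show ?thesis by simp
qed

text \<open>On [0, 1] the energy bounds n(n + 1) P_n^2, and parity covers negative x. The factor n(n
  + 1) vanishes for n = 0, hence the separate case.\<close>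

lemma abs_legendre_poly_le_1:
  assumes "x \<in> {-1..1}"
  shows "\<bar>poly (legendre_poly n) x\<bar> \<le> 1"
proof (cases "n = 0")
  case False
  have *: "\<bar>poly (legendre_poly n) y\<bar> \<le> 1" if y: "y \<in> {0..1}" for y
  proof -
    have "0 \<le> (1 - y\<^sup>2) * (poly (pderiv (legendre_poly n)) y)\<^sup>2"
      using y by (intro mult_nonneg_nonneg) (auto simp: abs_square_le_1)
    with legendre_energy_le_1[OF y, of n]
    have "real n * real (Suc n) * (poly (legendre_poly n) y)\<^sup>2 \<le> real n * real (Suc n) * 1"
      unfolding legendre_energy_def by linarith
    with False have "(poly (legendre_poly n) y)\<^sup>2 \<le> 1"
      by (subst (asm) mult_le_cancel_left_pos) auto
    then show ?thesis by (simp add: abs_square_le_1)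
  qed
  show ?thesis
  proof (cases "x \<ge> 0")
    case True
    with assms * show ?thesis by simp
  next
    case False
    with assms have "\<bar>poly (legendre_poly n) (- x)\<bar> \<le> 1"
      by (intro *) auto
    then show ?thesis by (simp add: legendre_poly_minus abs_mult)
  qed
qed simp

text \<open>A variant of Bernstein's inequality with weight 1 - x^2 instead of its square root. The
  energy at 0 is n(n + 1) P_n(0)^2 + n^2 P_(n-1)(0)^2, hence at most 2n by the bound for values at
  0.\<close>

lemma weighted_legendre_poly_squared_le:
  assumes "x \<in> {-1..1}"
  shows "(1 - x\<^sup>2) * (poly (legendre_poly n) x)\<^sup>2 \<le> 2 / (real n + 1)"
proof (cases n)
  case 0
  have "1 - x\<^sup>2 \<le> 2"
    using zero_le_power2[of x] by linarith
  with 0 show ?thesis by simp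
next
  case (Suc m)
  have *: "(1 - y\<^sup>2) * (poly (legendre_poly n) y)\<^sup>2 \<le> 2 / (real n + 1)" if y: "y \<in> {0..1}" for y
  proof -
    have y2: "0 \<le> 1 - y\<^sup>2"
      using y by (auto simp: abs_square_le_1)
    have "(1 - y\<^sup>2) * (real n * real (Suc n) * (poly (legendre_poly n) y)\<^sup>2)
        \<le> (1 - y\<^sup>2) * legendre_energy n y"
      using y2 by (intro mult_left_mono) (auto simp: legendre_energy_def)
    also have "\<dots> \<le> legendre_energy n 0"
      by (rule weighted_legendre_energy_le[OF y])
    also have "\<dots> = real n * (real n + 1) * (poly (legendre_poly n) 0)\<^sup>2 +
        (real m + 1)\<^sup>2 * (poly (legendre_poly m) 0)\<^sup>2"
      using legendre_deriv_down[of 0 m] unfolding legendre_energy_def Suc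
      by (simp add: power_mult_distrib algebra_simps del: of_nat_Suc) (simp add: algebra_simps)
    also have "\<dots> \<le> real n * (real n + 1) * (1 / (real n + 1)) + (real m + 1)\<^sup>2 * (1 / (real m + 1))"
      by (intro add_mono mult_left_mono legendre_poly_0_squared_le) auto
    also have "\<dots> = 2 * real n"
      using Suc by (simp add: power2_eq_square)
    finally have "real n * ((real n + 1) * ((1 - y\<^sup>2) * (poly (legendre_poly n) y)\<^sup>2)) \<le> real n * 2"
      by (simp add: algebra_simps)
    then have "(real n + 1) * ((1 - y\<^sup>2) * (poly (legendre_poly n) y)\<^sup>2) \<le> 2"
      using Suc by (subst (asm) mult_le_cancel_left_pos) auto
    then show ?thesis by (simp add: field_simps)
  qed
  show ?thesis
  proof (cases "x \<ge> 0")
    case True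
    with assms * show ?thesis by simp
  next
    case False
    with assms have "(1 - (-x)\<^sup>2) * (poly (legendre_poly n) (-x))\<^sup>2 \<le> 2 / (real n + 1)"
      by (intro *) auto
    then show ?thesis
      by (simp add: legendre_poly_minus power_mult_distrib flip: power_mult)
  qed
qed

lemma abs_le_sqrt_mult:
  assumes "y\<^sup>2 \<le> C * z"
  shows "\<bar>y\<bar> \<le> sqrt C * sqrt z"
  using assms by (metis real_sqrt_abs real_sqrt_le_iff real_sqrt_mult)

lemma legendre_poly_interior_bound:
  assumes "x \<in> {-1<..<1}"
  shows "\<exists>B\<ge>0. \<forall>n\<ge>1. \<bar>poly (legendre_poly n) x\<bar> \<le> B * sqrt (1 / real n)"
proof (intro exI conjI allI impI)
  have x: "0 < 1 - x\<^sup>2"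
    using assms abs_square_less_1[of x] by auto
  then show "0 \<le> sqrt (2 / (1 - x\<^sup>2))" by simp
  fix n :: nat assume n: "n \<ge> 1"
  have "(1 - x\<^sup>2) * (poly (legendre_poly n) x)\<^sup>2 \<le> 2 / (real n + 1)"
    using assms by (intro weighted_legendre_poly_squared_le) auto
  also have "\<dots> \<le> 2 / real n"
    using n by (intro divide_left_mono) auto
  finally have "(poly (legendre_poly n) x)\<^sup>2 \<le> 2 / real n / (1 - x\<^sup>2)"
    unfolding pos_le_divide_eq[OF x] by (simp only: mult.commute)
  then have "(poly (legendre_poly n) x)\<^sup>2 \<le> 2 / (1 - x\<^sup>2) * (1 / real n)"
    by (simp add: mult.commute)
  then show "\<bar>poly (legendre_poly n) x\<bar> \<le> sqrt (2 / (1 - x\<^sup>2)) * sqrt (1 / real n)"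
    by (rule abs_le_sqrt_mult)
qed

text \<open>One expression serves two regimes: near \<xi> it is of the sharp size n^(-1/2), and near
  1, where P_n is only bounded, it stays away from 0. At distance at least 1/n from \<xi> it becomes
  a pure power of t - \<xi>.\<close>

lemma legendre_poly_one_sided_bound:
  assumes "\<xi> \<in> {-1<..<1}"
  shows "\<exists>B\<ge>0. \<forall>n\<ge>1. \<forall>t\<in>{\<xi>..1}. \<bar>poly (legendre_poly n) t\<bar> \<le> B * sqrt (t - \<xi> + 1 / real n)"
proof -
  define \<delta> where "\<delta> = (1 + \<xi>) / 2"
  \<comment> \<open>On [\<xi>, \<delta>] the square t^2 is largest at an end point, so
    \<open>c\<close> bounds 1 - t^2 from below there.\<close>
  define c where "c = min (1 - \<xi>\<^sup>2) (1 - \<delta>\<^sup>2)"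
  have \<delta>: "\<xi> < \<delta>" "\<delta> < 1" "-1 < \<delta>"
    using assms by (auto simp: \<delta>_def)
  have c: "c > 0"
    using assms \<delta> abs_square_less_1[of \<xi>] abs_square_less_1[of \<delta>] by (auto simp: c_def)
  define A where "A = 2 / c + 1 / (\<delta> - \<xi>)"
  have A: "A \<ge> 0" "A \<ge> 2 / c" "A \<ge> 1 / (\<delta> - \<xi>)"
    using c \<delta> by (auto simp: A_def)
  have "\<bar>poly (legendre_poly n) t\<bar> \<le> sqrt A * sqrt (t - \<xi> + 1 / real n)"
    if n: "n \<ge> 1" and t: "t \<in> {\<xi>..1}" for n t
  proof (rule abs_le_sqrt_mult)
    show "(poly (legendre_poly n) t)\<^sup>2 \<le> A * (t - \<xi> + 1 / real n)"
    proof (cases "t \<le> \<delta>")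
      case True
      have "t\<^sup>2 \<le> max (\<xi>\<^sup>2) (\<delta>\<^sup>2)"
      proof (cases "t \<ge> 0")
        case 0: True
        then have "t\<^sup>2 \<le> \<delta>\<^sup>2" using True by (intro power_mono) auto
        then show ?thesis by simp
      next
        case False
        then have "(-t)\<^sup>2 \<le> (-\<xi>)\<^sup>2" using t by (intro power_mono) auto
        then show ?thesis by simp
      qed
      then have "c * (poly (legendre_poly n) t)\<^sup>2 \<le> (1 - t\<^sup>2) * (poly (legendre_poly n) t)\<^sup>2"
        by (intro mult_right_mono) (auto simp: c_def)
      also have "\<dots> \<le> 2 / (real n + 1)"
        using t assms by (intro weighted_legendre_poly_squared_le) auto
      also have "\<dots> \<le> 2 / real n"
        using n by (intro divide_left_mono) auto
      finally have "(poly (legendre_poly n) t)\<^sup>2 \<le> 2 / real n / c"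
        unfolding pos_le_divide_eq[OF c] by (simp only: mult.commute)
      then have "(poly (legendre_poly n) t)\<^sup>2 \<le> 2 / c * (1 / real n)"
        by (simp add: mult.commute)
      also have "\<dots> \<le> A * (t - \<xi> + 1 / real n)"
        using A c t by (intro mult_mono) auto
      finally show ?thesis .
    next
      case False
      have "(poly (legendre_poly n) t)\<^sup>2 \<le> 1"
        using abs_legendre_poly_le_1[of t n] t assms by (simp add: abs_square_le_1)
      also have "1 = 1 / (\<delta> - \<xi>) * (\<delta> - \<xi>)"
        using \<delta> by simp
      also have "\<dots> \<le> A * (t - \<xi> + 1 / real n)"
      proof (intro mult_mono)
        have "0 \<le> 1 / real n" by simp
        then show "\<delta> - \<xi> \<le> t - \<xi> + 1 / real n" using False by linarith
      qed (use A \<delta> in auto)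
      finally show ?thesis .
    qed
  qed
  moreover have "sqrt A \<ge> 0" using A by simp
  ultimately show ?thesis by blast
qed

text \<open>For \<open>n > k\<close> this is the \<open>k\<close>-fold primitive of \<open>P\<^sub>n\<close> that vanishes at both end points; for
  smaller \<open>n\<close> the truncated subtraction makes it meaningless.\<close>

primrec legendre_primitive :: "nat \<Rightarrow> nat \<Rightarrow> real poly" where
  "legendre_primitive 0 n = legendre_poly n"
| "legendre_primitive (Suc k) n =
     smult (1 / (2 * real n + 1)) (legendre_primitive k (Suc n) - legendre_primitive k (n - 1))"

text \<open>The base case is (2n + 1) P_n = P'_(n+1) - P'_(n-1), and the recursion is linear. The
  condition \<open>k < n\<close> passes to \<open>n - 1\<close> when k drops by one.\<close>

lemma pderiv_legendre_primitive:
  "k < n \<Longrightarrow> pderiv (legendre_primitive (Suc k) n) = legendre_primitive k n"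
proof (induction k arbitrary: n)
  case 0
  then obtain m where n: "n = Suc m" using gr0_conv_Suc by auto
  have "2 * real m + 3 = 2 * real n + 1" by (simp add: n)
  then show ?case
    by (simp add: n pderiv_smult pderiv_diff pderiv_legendre_poly_Suc_Suc add_ac)
next
  case (Suc k)
  then have "pderiv (legendre_primitive (Suc k) (Suc n)) = legendre_primitive k (Suc n)"
    "pderiv (legendre_primitive (Suc k) (n - 1)) = legendre_primitive k (n - 1)"
    by (auto simp del: legendre_primitive.simps)
  then show ?case
    by (subst legendre_primitive.simps) (simp only: pderiv_smult pderiv_diff legendre_primitive.simps(2)[of k n])
qed

text \<open>The degrees n + 1 and n - 1 have the same parity, so the two Legendre polynomials agree
  at each end point.\<close>

lemma legendre_primitive_at_end:
  assumes "k < n" "x = 1 \<or> x = -1"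
  shows "poly (legendre_primitive (Suc k) n) x = 0"
  using assms(1)
proof (induction k arbitrary: n)
  case 0
  then obtain m where "n = Suc m" using gr0_conv_Suc by auto
  then show ?case
    using assms(2) by (auto simp: poly_legendre_poly_neg_1)
next
  case (Suc k)
  then have "poly (legendre_primitive (Suc k) (Suc n)) x = 0"
    "poly (legendre_primitive (Suc k) (n - 1)) x = 0"
    by (auto simp del: legendre_primitive.simps)
  then show ?case
    by (subst legendre_primitive.simps) (simp only: poly_smult poly_diff diff_self mult_zero_right)
qed

text \<open>Each level divides by 2n + 1, while replacing the index n by a neighbour costs only a
  constant factor.\<close>

lemma legendre_primitive_bound:
  assumes "\<xi> \<in> {-1<..<1}"
  shows "\<exists>B\<ge>0. \<forall>n>k. \<forall>t\<in>{\<xi>..1}.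
    \<bar>poly (legendre_primitive k n) t\<bar> \<le> B / real n ^ k * sqrt (t - \<xi> + 1 / real n)"
proof (induction k)
  case 0
  then show ?case
    using legendre_poly_one_sided_bound[OF assms] by (auto simp: Suc_le_eq)
next
  case (Suc k)
  then obtain B where B: "B \<ge> 0" and bd: "\<And>n t. n > k \<Longrightarrow> t \<in> {\<xi>..1} \<Longrightarrow>
    \<bar>poly (legendre_primitive k n) t\<bar> \<le> B / real n ^ k * sqrt (t - \<xi> + 1 / real n)"
    by metis
  \<comment> \<open>The summand 1 belongs to index n + 1. Index n - 1, which is at least n/2, costs
    2^k from the power of n and sqrt 2 from 1/(n - 1) \<le> 2/n.\<close>
  let ?C = "B * (1 + 2 ^ k * sqrt 2)"
  have "\<bar>poly (legendre_primitive (Suc k) n) t\<bar> \<le> ?C / real n ^ Suc k * sqrt (t - \<xi> + 1 / real n)"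
    if n: "n > Suc k" and t: "t \<in> {\<xi>..1}" for n t
  proof -
    let ?w = "sqrt (t - \<xi> + 1 / real n)"
    have t0: "t - \<xi> \<ge> 0" using t by simp
    have half: "real n / 2 \<le> real (n - 1)" "real n > 0"
      using n by (auto simp: of_nat_diff)
    have "\<bar>poly (legendre_primitive k (Suc n)) t\<bar> \<le> B / real (Suc n) ^ k * sqrt (t - \<xi> + 1 / real (Suc n))"
      using n t by (intro bd) auto
    also have "\<dots> \<le> B / real n ^ k * ?w"
      using t0 half B by (intro mult_mono divide_left_mono power_mono real_sqrt_le_mono add_left_mono) auto
    finally have 1: "\<bar>poly (legendre_primitive k (Suc n)) t\<bar> \<le> B / real n ^ k * ?w" .
    have pos: "0 < real (n - 1)" using half by linarith
    have "\<bar>poly (legendre_primitive k (n - 1)) t\<bar> \<le> B / real (n - 1) ^ k * sqrt (t - \<xi> + 1 / real (n - 1))"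
      using n t by (intro bd) auto
    also have "\<dots> \<le> B / (real n / 2) ^ k * sqrt (2 * (t - \<xi> + 1 / real n))"
    proof (intro mult_mono)
      show "B / real (n - 1) ^ k \<le> B / (real n / 2) ^ k"
        using half pos B by (intro divide_left_mono power_mono mult_pos_pos zero_less_power) auto
      have "1 / real (n - 1) \<le> 1 / (real n / 2)"
        using half pos by (intro divide_left_mono mult_pos_pos) auto
      then show "sqrt (t - \<xi> + 1 / real (n - 1)) \<le> sqrt (2 * (t - \<xi> + 1 / real n))"
        using t0 by (intro real_sqrt_le_mono) simp
    qed (use B t0 in auto)
    also have "\<dots> = B * (2 ^ k * sqrt 2) / real n ^ k * ?w"
      unfolding real_sqrt_mult by (simp add: power_divide)
    finally have 2: "\<bar>poly (legendre_primitive k (n - 1)) t\<bar> \<le> B * (2 ^ k * sqrt 2) / real n ^ k * ?w" .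
    have "\<bar>poly (legendre_primitive (Suc k) n) t\<bar> =
        1 / (2 * real n + 1) * \<bar>poly (legendre_primitive k (Suc n)) t - poly (legendre_primitive k (n - 1)) t\<bar>"
      by (simp add: abs_mult)
    also have "\<dots> \<le> 1 / real n * (B / real n ^ k * ?w + B * (2 ^ k * sqrt 2) / real n ^ k * ?w)"
      using half 1 2 by (intro mult_mono divide_left_mono order_trans[OF abs_triangle_ineq4 add_mono]) auto
    also have "\<dots> = ?C / real n ^ Suc k * ?w"
      by (simp add: algebra_simps add_divide_distrib)
    finally show ?thesis .
  qed
  moreover have "?C \<ge> 0" using B by simp
  ultimately show ?case by blast
qed

text \<open>The boundary term at 1 drops out because the primitive vanishes there; only the one at a
  remains.\<close>

lemma integral_by_parts_legendre_primitive:
  fixes h h' :: "real \<Rightarrow> real"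
  assumes "k < n" "a \<le> 1"
    and deriv: "\<And>t. t \<in> {a..1} \<Longrightarrow> (h has_real_derivative h' t) (at t within {a..1})"
    and cont: "continuous_on {a..1} h'"
  shows "integral {a..1} (\<lambda>t. h t * poly (legendre_primitive k n) t) =
    - h a * poly (legendre_primitive (Suc k) n) a
    - integral {a..1} (\<lambda>t. h' t * poly (legendre_primitive (Suc k) n) t)"
proof -
  let ?L = "poly (legendre_primitive (Suc k) n)" and ?L' = "poly (legendre_primitive k n)"
  have conth: "continuous_on {a..1} h"
    using deriv DERIV_continuous_on by blast
  have "((\<lambda>t. h' t * ?L t + h t * ?L' t) has_integral (h 1 * ?L 1 - h a * ?L a)) {a..1}"
  proof (rule fundamental_theorem_of_calculus[OF \<open>a \<le> 1\<close>])
    fix t assume "t \<in> {a..1}"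
    moreover have "(?L has_real_derivative ?L' t) (at t within {a..1})"
      using poly_DERIV[of "legendre_primitive (Suc k) n" t] pderiv_legendre_primitive[OF \<open>k < n\<close>]
      by (metis has_field_derivative_at_within)
    ultimately have "((\<lambda>t. h t * ?L t) has_real_derivative h' t * ?L t + h t * ?L' t) (at t within {a..1})"
      using DERIV_mult[OF deriv, of t ?L "?L' t"] by (simp only: mult.commute)
    then show "((\<lambda>t. h t * ?L t) has_vector_derivative h' t * ?L t + h t * ?L' t) (at t within {a..1})"
      by (rule has_real_derivative_iff_has_vector_derivative[THEN iffD1])
  qed
  moreover have "?L 1 = 0"
    using legendre_primitive_at_end[OF \<open>k < n\<close>] by blast
  ultimately have "integral {a..1} (\<lambda>t. h' t * ?L t + h t * ?L' t) = - h a * ?L a"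
    by (simp add: integral_unique)
  moreover have "integral {a..1} (\<lambda>t. h' t * ?L t + h t * ?L' t) =
      integral {a..1} (\<lambda>t. h' t * ?L t) + integral {a..1} (\<lambda>t. h t * ?L' t)"
    by (intro integral_add integrable_continuous_real continuous_intros cont conth)
  ultimately show ?thesis by linarith
qed

section \<open>Integrals of functions with an algebraic singularity\<close>

text \<open>The whole sequence of derivatives is carried along, so that differentiation is a shift
  of the index. The half-open interval admits blow-up at \<xi> and keeps the end point 1; the
  constant may depend on k.\<close>

definition singular_derivs :: "real \<Rightarrow> real \<Rightarrow> (nat \<Rightarrow> real \<Rightarrow> real) \<Rightarrow> bool" where
  "singular_derivs \<xi> \<beta> H \<longleftrightarrow> (\<forall>k.
     (\<forall>t\<in>{\<xi><..1}. (H k has_real_derivative H (Suc k) t) (at t within {\<xi><..1})) \<and>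
     (\<exists>C\<ge>0. \<forall>t\<in>{\<xi><..1}. \<bar>H k t\<bar> \<le> C * (t - \<xi>) powr (\<beta> - real k)))"

lemma singular_derivsD:
  assumes "singular_derivs \<xi> \<beta> H"
  shows "t \<in> {\<xi><..1} \<Longrightarrow> (H k has_real_derivative H (Suc k) t) (at t within {\<xi><..1})"
    and "\<exists>C\<ge>0. \<forall>t\<in>{\<xi><..1}. \<bar>H k t\<bar> \<le> C * (t - \<xi>) powr (\<beta> - real k)"
  using assms unfolding singular_derivs_def by blast+

lemma singular_derivs_continuous:
  assumes "singular_derivs \<xi> \<beta> H"
  shows "continuous_on {\<xi><..1} (H k)"
  using singular_derivsD(1)[OF assms] DERIV_continuous_on by blast

lemma singular_derivs_shift:
  assumes "singular_derivs \<xi> \<beta> H"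
  shows "singular_derivs \<xi> (\<beta> - 1) (\<lambda>k. H (Suc k))"
  unfolding singular_derivs_def
proof (intro allI conjI ballI)
  fix k
  show "\<exists>C\<ge>0. \<forall>t\<in>{\<xi><..1}. \<bar>H (Suc k) t\<bar> \<le> C * (t - \<xi>) powr (\<beta> - 1 - real k)"
    using singular_derivsD(2)[OF assms, of "Suc k"] by (simp add: algebra_simps)
qed (rule singular_derivsD(1)[OF assms])

lemma has_integral_powr_right:
  fixes \<xi> \<epsilon> \<gamma> :: real
  assumes "0 < \<epsilon>" "\<xi> + \<epsilon> \<le> b" "\<gamma> \<noteq> -1"
  shows "((\<lambda>t. (t - \<xi>) powr \<gamma>) has_integral
    ((b - \<xi>) powr (\<gamma> + 1) / (\<gamma> + 1) - \<epsilon> powr (\<gamma> + 1) / (\<gamma> + 1))) {\<xi> + \<epsilon>..b}"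
proof -
  have "((\<lambda>t. (t - \<xi>) powr \<gamma>) has_integral
    ((b - \<xi>) powr (\<gamma> + 1) / (\<gamma> + 1) - (\<xi> + \<epsilon> - \<xi>) powr (\<gamma> + 1) / (\<gamma> + 1))) {\<xi> + \<epsilon>..b}"
  proof (rule fundamental_theorem_of_calculus)
    fix t assume "t \<in> {\<xi> + \<epsilon>..b}"
    then have "((\<lambda>t. (t - \<xi>) powr (\<gamma> + 1) / (\<gamma> + 1)) has_real_derivative (t - \<xi>) powr \<gamma>)
        (at t within {\<xi> + \<epsilon>..b})"
      using assms by (auto intro!: derivative_eq_intros)
    then show "((\<lambda>t. (t - \<xi>) powr (\<gamma> + 1) / (\<gamma> + 1)) has_vector_derivative (t - \<xi>) powr \<gamma>)
        (at t within {\<xi> + \<epsilon>..b})"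
      by (rule has_real_derivative_iff_has_vector_derivative[THEN iffD1])
  qed (use assms in auto)
  then show ?thesis by simp
qed

text \<open>For negative \<gamma> the integrand is unbounded near \<xi>, but \<gamma> + 1 > 0 keeps
  the primitive continuous up to \<xi>, so derivatives in the interior suffice.\<close>

lemma has_integral_powr_left:
  fixes \<xi> \<epsilon> \<gamma> :: real
  assumes "0 < \<epsilon>" "-1 < \<gamma>"
  shows "((\<lambda>t. (t - \<xi>) powr \<gamma>) has_integral \<epsilon> powr (\<gamma> + 1) / (\<gamma> + 1)) {\<xi>..\<xi> + \<epsilon>}"
proof -
  have "((\<lambda>t. (t - \<xi>) powr \<gamma>) has_integral
    ((\<xi> + \<epsilon> - \<xi>) powr (\<gamma> + 1) / (\<gamma> + 1) - (\<xi> - \<xi>) powr (\<gamma> + 1) / (\<gamma> + 1))) {\<xi>..\<xi> + \<epsilon>}"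
  proof (rule fundamental_theorem_of_calculus_interior)
    show "continuous_on {\<xi>..\<xi> + \<epsilon>} (\<lambda>t. (t - \<xi>) powr (\<gamma> + 1) / (\<gamma> + 1))"
      using assms by (intro continuous_intros continuous_on_powr') auto
    fix t assume "t \<in> {\<xi><..<\<xi> + \<epsilon>}"
    then have "((\<lambda>t. (t - \<xi>) powr (\<gamma> + 1) / (\<gamma> + 1)) has_real_derivative (t - \<xi>) powr \<gamma>) (at t)"
      using assms by (auto intro!: derivative_eq_intros)
    then show "((\<lambda>t. (t - \<xi>) powr (\<gamma> + 1) / (\<gamma> + 1)) has_vector_derivative (t - \<xi>) powr \<gamma>) (at t)"
      by (rule has_real_derivative_iff_has_vector_derivative[THEN iffD1])
  qed (use assms in auto)
  then show ?thesis by simp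
qed

text \<open>In this range the summand 1/n under the root is absorbed by t - \<xi>.\<close>

lemma legendre_primitive_bound_right:
  assumes "\<xi> \<in> {-1<..<1}"
  shows "\<exists>B\<ge>0. \<forall>n>k. \<forall>t. \<xi> + 1 / real n \<le> t \<longrightarrow> t \<le> 1 \<longrightarrow>
    \<bar>poly (legendre_primitive k n) t\<bar> \<le> B / real n ^ k * (t - \<xi>) powr (1 / 2)"
proof -
  obtain B where B: "B \<ge> 0" and bd: "\<And>n t. n > k \<Longrightarrow> t \<in> {\<xi>..1} \<Longrightarrow>
    \<bar>poly (legendre_primitive k n) t\<bar> \<le> B / real n ^ k * sqrt (t - \<xi> + 1 / real n)"
    using legendre_primitive_bound[OF assms] by metis
  have "\<bar>poly (legendre_primitive k n) t\<bar> \<le> B * sqrt 2 / real n ^ k * (t - \<xi>) powr (1 / 2)"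
    if n: "n > k" and t: "\<xi> + 1 / real n \<le> t" "t \<le> 1" for n t
  proof -
    have pos: "0 < 1 / real n" using n by simp
    then have "0 \<le> t - \<xi>" using t by linarith
    with t have "t \<in> {\<xi>..1}" by simp
    have "\<bar>poly (legendre_primitive k n) t\<bar> \<le> B / real n ^ k * sqrt (t - \<xi> + 1 / real n)"
      by (rule bd) fact+
    also have "\<dots> \<le> B / real n ^ k * sqrt (2 * (t - \<xi>))"
      using B t pos by (intro mult_left_mono real_sqrt_le_mono) auto
    also have "\<dots> = B * sqrt 2 / real n ^ k * (t - \<xi>) powr (1 / 2)"
      using \<open>0 \<le> t - \<xi>\<close> by (simp only: real_sqrt_mult powr_half_sqrt) simp
    finally show ?thesis .
  qed
  then show ?thesis using B by (intro exI[of _ "B * sqrt 2"]) auto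
qed

text \<open>Here m counts integrations by parts. Each lowers \<beta> and raises k by one, gaining
  1/n and losing 1/\<epsilon>, which is no loss overall as 1/n \<le> \<epsilon>. Once \<beta> + 3/2
  < 0, absolute values can be taken, and the integral is governed by its lower end point.\<close>

lemma singular_integral_bound:
  assumes \<xi>: "\<xi> \<in> {-1<..<1}"
  shows "singular_derivs \<xi> \<beta> H \<Longrightarrow> \<beta> < real m - 3 / 2 \<Longrightarrow>
    \<exists>C\<ge>0. \<forall>n>k + m. \<forall>\<epsilon>. 1 / real n \<le> \<epsilon> \<longrightarrow> \<xi> + \<epsilon> \<le> 1 \<longrightarrow>
      \<bar>integral {\<xi> + \<epsilon>..1} (\<lambda>t. H 0 t * poly (legendre_primitive k n) t)\<bar>
        \<le> C / real n ^ k * \<epsilon> powr (\<beta> + 3 / 2)"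
proof (induction m arbitrary: \<beta> H k)
  case 0
  obtain C where C: "C \<ge> 0" "\<And>t. t \<in> {\<xi><..1} \<Longrightarrow> \<bar>H 0 t\<bar> \<le> C * (t - \<xi>) powr \<beta>"
    using singular_derivsD(2)[OF "0.prems"(1), of 0] by auto
  obtain B where B: "B \<ge> 0" "\<And>n t. n > k \<Longrightarrow> \<xi> + 1 / real n \<le> t \<Longrightarrow> t \<le> 1 \<Longrightarrow>
    \<bar>poly (legendre_primitive k n) t\<bar> \<le> B / real n ^ k * (t - \<xi>) powr (1 / 2)"
    using legendre_primitive_bound_right[OF \<xi>] by metis
  \<comment> \<open>The integral of (t - \<xi>)^(\<beta> + 1/2) from \<xi> + \<epsilon> to 1 is at
    most \<epsilon>^(\<beta> + 3/2) / -(\<beta> + 3/2): as \<beta> + 3/2 < 0, the contribution of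
    the upper end point is nonpositive.\<close>
  let ?D = "C * B / (- (\<beta> + 3 / 2))"
  have \<beta>: "\<beta> + 3 / 2 < 0" using 0 by simp
  have "\<bar>integral {\<xi> + \<epsilon>..1} (\<lambda>t. H 0 t * poly (legendre_primitive k n) t)\<bar>
        \<le> ?D / real n ^ k * \<epsilon> powr (\<beta> + 3 / 2)"
    if n: "n > k" and \<epsilon>: "1 / real n \<le> \<epsilon>" "\<xi> + \<epsilon> \<le> 1" for n \<epsilon>
  proof -
    have \<epsilon>0: "\<epsilon> > 0" using n \<epsilon> by (smt (verit) divide_pos_pos of_nat_0_less_iff gr_implies_not0 neq0_conv)
    let ?c = "C * B / real n ^ k"
    have I: "((\<lambda>t. ?c * (t - \<xi>) powr (\<beta> + 1 / 2)) has_integral ?c *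
      ((1 - \<xi>) powr (\<beta> + 1 / 2 + 1) / (\<beta> + 1 / 2 + 1) - \<epsilon> powr (\<beta> + 1 / 2 + 1) / (\<beta> + 1 / 2 + 1))) {\<xi> + \<epsilon>..1}"
      using \<epsilon>0 \<epsilon> \<beta> by (intro has_integral_mult_right has_integral_powr_right) auto
    have "norm (integral {\<xi> + \<epsilon>..1} (\<lambda>t. H 0 t * poly (legendre_primitive k n) t))
      \<le> integral {\<xi> + \<epsilon>..1} (\<lambda>t. ?c * (t - \<xi>) powr (\<beta> + 1 / 2))"
    proof (rule integral_norm_bound_integral)
      have "continuous_on {\<xi> + \<epsilon>..1} (H 0)"
        using \<epsilon>0 by (intro continuous_on_subset[OF singular_derivs_continuous[OF "0.prems"(1)]]) auto
      then show "(\<lambda>t. H 0 t * poly (legendre_primitive k n) t) integrable_on {\<xi> + \<epsilon>..1}"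
        by (intro integrable_continuous_real continuous_intros)
      fix t assume t: "t \<in> {\<xi> + \<epsilon>..1}"
      have "norm (H 0 t * poly (legendre_primitive k n) t) \<le>
          (C * (t - \<xi>) powr \<beta>) * (B / real n ^ k * (t - \<xi>) powr (1 / 2))"
        unfolding real_norm_def abs_mult using t n \<epsilon> \<epsilon>0 C(1)
        by (intro mult_mono C B) auto
      also have "\<dots> = ?c * (t - \<xi>) powr (\<beta> + 1 / 2)"
        by (simp add: powr_add)
      finally show "norm (H 0 t * poly (legendre_primitive k n) t) \<le> ?c * (t - \<xi>) powr (\<beta> + 1 / 2)" .
    qed (use I in blast)
    also have "\<dots> = ?c * ((1 - \<xi>) powr (\<beta> + 3 / 2) / (\<beta> + 3 / 2) - \<epsilon> powr (\<beta> + 3 / 2) / (\<beta> + 3 / 2))"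
      using integral_unique[OF I] by (simp add: add.assoc)
    also have "\<dots> \<le> ?c * (- (\<epsilon> powr (\<beta> + 3 / 2)) / (\<beta> + 3 / 2))"
      using B(1) C(1) \<beta> by (intro mult_left_mono) (auto simp: divide_nonneg_neg)
    also have "\<dots> = ?D / real n ^ k * \<epsilon> powr (\<beta> + 3 / 2)"
      unfolding divide_minus_right by (simp add: mult_ac)
    finally show ?thesis by simp
  qed
  moreover have "?D \<ge> 0" using B(1) C(1) \<beta> by (intro divide_nonneg_pos) auto
  ultimately show ?case by (intro exI[of _ ?D]) auto
next
  case (Suc m)
  obtain C where C: "C \<ge> 0" "\<And>t. t \<in> {\<xi><..1} \<Longrightarrow> \<bar>H 0 t\<bar> \<le> C * (t - \<xi>) powr \<beta>"
    using singular_derivsD(2)[OF Suc.prems(1), of 0] by auto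
  obtain B where B: "B \<ge> 0" "\<And>n t. n > Suc k \<Longrightarrow> \<xi> + 1 / real n \<le> t \<Longrightarrow> t \<le> 1 \<Longrightarrow>
    \<bar>poly (legendre_primitive (Suc k) n) t\<bar> \<le> B / real n ^ Suc k * (t - \<xi>) powr (1 / 2)"
    using legendre_primitive_bound_right[OF \<xi>] by metis
  have "singular_derivs \<xi> (\<beta> - 1) (\<lambda>k. H (Suc k))" "\<beta> - 1 < real m - 3 / 2"
    using singular_derivs_shift[OF Suc.prems(1)] Suc.prems(2) by auto
  from Suc.IH[OF this, of "Suc k"] obtain D where D: "D \<ge> 0"
    "\<And>n \<epsilon>. n > Suc k + m \<Longrightarrow> 1 / real n \<le> \<epsilon> \<Longrightarrow> \<xi> + \<epsilon> \<le> 1 \<Longrightarrow>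
      \<bar>integral {\<xi> + \<epsilon>..1} (\<lambda>t. H (Suc 0) t * poly (legendre_primitive (Suc k) n) t)\<bar>
        \<le> D / real n ^ Suc k * \<epsilon> powr (\<beta> - 1 + 3 / 2)"
    by blast
  have "\<bar>integral {\<xi> + \<epsilon>..1} (\<lambda>t. H 0 t * poly (legendre_primitive k n) t)\<bar>
        \<le> (C * B + D) / real n ^ k * \<epsilon> powr (\<beta> + 3 / 2)"
    if n: "n > k + Suc m" and \<epsilon>: "1 / real n \<le> \<epsilon>" "\<xi> + \<epsilon> \<le> 1" for n \<epsilon>
  proof -
    let ?L = "poly (legendre_primitive (Suc k) n)"
    have \<epsilon>0: "\<epsilon> > 0" using n \<epsilon> by (smt (verit) divide_pos_pos of_nat_0_less_iff gr_implies_not0 neq0_conv)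
    have sub: "{\<xi> + \<epsilon>..1} \<subseteq> {\<xi><..1}" using \<epsilon>0 by auto
    have "\<bar>H 0 (\<xi> + \<epsilon>) * ?L (\<xi> + \<epsilon>)\<bar> \<le>
        (C * (\<xi> + \<epsilon> - \<xi>) powr \<beta>) * (B / real n ^ Suc k * (\<xi> + \<epsilon> - \<xi>) powr (1 / 2))"
      unfolding abs_mult using n \<epsilon> \<epsilon>0 C(1) by (intro mult_mono C B) auto
    also have "\<dots> = C * B / real n ^ Suc k * \<epsilon> powr (\<beta> + 1 / 2)"
      by (simp add: powr_add)
    finally have 1: "\<bar>H 0 (\<xi> + \<epsilon>) * ?L (\<xi> + \<epsilon>)\<bar> \<le> C * B / real n ^ Suc k * \<epsilon> powr (\<beta> + 1 / 2)" .
    have 2: "\<bar>integral {\<xi> + \<epsilon>..1} (\<lambda>t. H (Suc 0) t * ?L t)\<bar> \<le> D / real n ^ Suc k * \<epsilon> powr (\<beta> + 1 / 2)"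
      using D(2)[of n \<epsilon>] n \<epsilon> by (simp del: legendre_primitive.simps add: algebra_simps)
    have "integral {\<xi> + \<epsilon>..1} (\<lambda>t. H 0 t * poly (legendre_primitive k n) t) =
        - H 0 (\<xi> + \<epsilon>) * ?L (\<xi> + \<epsilon>) - integral {\<xi> + \<epsilon>..1} (\<lambda>t. H (Suc 0) t * ?L t)"
      using n \<epsilon> sub
      by (intro integral_by_parts_legendre_primitive
          has_field_derivative_subset[OF singular_derivsD(1)[OF Suc.prems(1)]]
          continuous_on_subset[OF singular_derivs_continuous[OF Suc.prems(1)]]) auto
    then have "\<bar>integral {\<xi> + \<epsilon>..1} (\<lambda>t. H 0 t * poly (legendre_primitive k n) t)\<bar> \<le>
        C * B / real n ^ Suc k * \<epsilon> powr (\<beta> + 1 / 2) + D / real n ^ Suc k * \<epsilon> powr (\<beta> + 1 / 2)"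
      using 1 2 by linarith
    also have "\<dots> = (C * B + D) / real n ^ k * (\<epsilon> powr (\<beta> + 1 / 2) * (1 / real n))"
      by (simp add: add_divide_distrib algebra_simps)
    \<comment> \<open>The additional 1/n of the primitive pays for the power of \<epsilon> lost by
      differentiating H.\<close>
    also have "\<dots> \<le> (C * B + D) / real n ^ k * (\<epsilon> powr (\<beta> + 1 / 2) * \<epsilon>)"
      using \<epsilon> B(1) C(1) D(1) by (intro mult_left_mono) auto
    also have "\<epsilon> powr (\<beta> + 1 / 2) * \<epsilon> = \<epsilon> powr (\<beta> + 3 / 2)"
      using \<epsilon>0 powr_add[of \<epsilon> "\<beta> + 1 / 2" 1] by (simp add: add.assoc)
    finally show ?thesis .
  qed
  moreover have "C * B + D \<ge> 0" using B(1) C(1) D(1) by simp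
  ultimately show ?case by (intro exI[of _ "C * B + D"]) auto
qed

text \<open>Christoffel-Darboux trades the factor x - t for a factor of order n, and the integral is
  cut at distance \<epsilon> = 1/n from \<xi>. Both pieces are then of order \<rho> n
  \<epsilon>^(\<beta> + 3/2). The bound \<rho> is quantified after C, so it may later depend on
  n.\<close>

lemma legendre_kernel_integral_bound:
  assumes \<xi>: "\<xi> \<in> {-1<..<1}" and H: "singular_derivs \<xi> \<beta> H" and \<beta>: "\<beta> > -1"
    and contq: "continuous_on {\<xi>..1} q" and q\<xi>: "q \<xi> = 0"
    and q: "\<And>t. t \<in> {\<xi><..1} \<Longrightarrow> q t = (x - t) * H 0 t"
  shows "\<exists>C\<ge>0. \<forall>\<^sub>F n in sequentially. \<forall>\<rho>.
    \<bar>poly (legendre_poly n) x\<bar> \<le> \<rho> \<longrightarrow> \<bar>poly (legendre_poly (Suc n)) x\<bar> \<le> \<rho> \<longrightarrow>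
    \<bar>integral {\<xi>..1} (\<lambda>t. q t * legendre_kernel n x t)\<bar> \<le> C * \<rho> * real n powr (- \<beta> - 1 / 2)"
proof -
  obtain C where C: "C \<ge> 0" "\<And>t. t \<in> {\<xi><..1} \<Longrightarrow> \<bar>H 0 t\<bar> \<le> C * (t - \<xi>) powr \<beta>"
    using singular_derivsD(2)[OF H, of 0] by auto
  obtain B where B: "B \<ge> 0" "\<And>n t. n \<ge> 1 \<Longrightarrow> t \<in> {\<xi>..1} \<Longrightarrow>
    \<bar>poly (legendre_poly n) t\<bar> \<le> B * sqrt (t - \<xi> + 1 / real n)"
    using legendre_poly_one_sided_bound[OF \<xi>] by metis
  \<comment> \<open>Enough integrations by parts for the base case of
    \<open>singular_integral_bound\<close>.\<close>
  obtain m :: nat where m: "\<beta> < real m - 3 / 2"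
    using reals_Archimedean2[of "\<beta> + 3 / 2"] by (auto simp: algebra_simps)
  obtain D where D: "D \<ge> 0" "\<And>n \<epsilon>. n > m \<Longrightarrow> 1 / real n \<le> \<epsilon> \<Longrightarrow> \<xi> + \<epsilon> \<le> 1 \<Longrightarrow>
      \<bar>integral {\<xi> + \<epsilon>..1} (\<lambda>t. H 0 t * poly (legendre_poly n) t)\<bar> \<le> D * \<epsilon> powr (\<beta> + 3 / 2)"
    using singular_integral_bound[OF \<xi> H m, of 0] by auto
  let ?E = "2 * (C * B * sqrt 2) / (\<beta> + 1) + 2 * D"
  have "\<forall>\<^sub>F n in sequentially. 1 / real n < 1 - \<xi>"
    using \<xi> by (intro order_tendstoD[OF lim_1_over_n]) auto
  then have ev: "\<forall>\<^sub>F n in sequentially. 1 / real n < 1 - \<xi> \<and> n > m"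
    using eventually_gt_at_top eventually_conj by blast
  have "\<bar>integral {\<xi>..1} (\<lambda>t. q t * legendre_kernel n x t)\<bar> \<le> ?E * \<rho> * real n powr (- \<beta> - 1 / 2)"
    if n: "1 / real n < 1 - \<xi>" "n > m"
      and \<rho>: "\<bar>poly (legendre_poly n) x\<bar> \<le> \<rho>" "\<bar>poly (legendre_poly (Suc n)) x\<bar> \<le> \<rho>" for n \<rho>
  proof -
    define \<epsilon> where "\<epsilon> = 1 / real n"
    have n1: "real n \<ge> 1" using n by simp
    have \<epsilon>: "0 < \<epsilon>" "\<xi> + \<epsilon> \<le> 1" "1 / real (Suc n) \<le> \<epsilon>" "\<epsilon> = real n powr (- 1)"
      using n n1 by (auto simp: \<epsilon>_def powr_minus_divide frac_le)
    have \<rho>0: "\<rho> \<ge> 0" using \<rho>(1) by linarith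
    let ?I = "\<lambda>n. integral {\<xi> + \<epsilon>..1} (\<lambda>t. H 0 t * poly (legendre_poly n) t)"
    let ?c = "real (Suc n) / 2 * (2 * \<rho> * (B * sqrt (2 * \<epsilon>))) * C"
    have CD: "q t * legendre_kernel n x t = real (Suc n) / 2 *
        (poly (legendre_poly (Suc n)) x * (H 0 t * poly (legendre_poly n) t)
         - poly (legendre_poly n) x * (H 0 t * poly (legendre_poly (Suc n)) t))"
      if "t \<in> {\<xi><..1}" for t
      using christoffel_darboux[of x t n] q[OF that] by (simp only: mult.assoc) algebra
    \<comment> \<open>On the short piece both Legendre polynomials are at most a multiple of sqrt
      \<epsilon>, and \<beta> > -1 makes the bound for H integrable.\<close>
    have "norm (integral {\<xi>..\<xi> + \<epsilon>} (\<lambda>t. q t * legendre_kernel n x t)) \<le>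
        integral {\<xi>..\<xi> + \<epsilon>} (\<lambda>t. ?c * (t - \<xi>) powr \<beta>)"
    proof (rule integral_norm_bound_integral)
      show "(\<lambda>t. q t * legendre_kernel n x t) integrable_on {\<xi>..\<xi> + \<epsilon>}"
        using \<epsilon> by (intro integrable_continuous_real continuous_intros continuous_on_subset[OF contq]) auto
      show "(\<lambda>t. ?c * (t - \<xi>) powr \<beta>) integrable_on {\<xi>..\<xi> + \<epsilon>}"
        using has_integral_powr_left[OF \<epsilon>(1) \<beta>] by (intro integrable_on_mult_right) blast
      fix t assume t: "t \<in> {\<xi>..\<xi> + \<epsilon>}"
      show "norm (q t * legendre_kernel n x t) \<le> ?c * (t - \<xi>) powr \<beta>"
      \<comment> \<open>Nothing is known about \<open>H 0\<close> at \<xi> itself; there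
        \<open>q\<close> vanishes.\<close>
      proof (cases "t = \<xi>")
        case True
        then show ?thesis by (simp add: q\<xi>)
      next
        case False
        then have t': "t \<in> {\<xi><..1}" "t \<in> {\<xi>..1}" using t \<epsilon> by auto
        have "\<bar>poly (legendre_poly n) t\<bar> \<le> B * sqrt (t - \<xi> + 1 / real n)"
          using n t' by (intro B) auto
        also have "\<dots> \<le> B * sqrt (2 * \<epsilon>)"
          using t B(1) by (intro mult_left_mono real_sqrt_le_mono) (auto simp: \<epsilon>_def)
        finally have P1: "\<bar>poly (legendre_poly n) t\<bar> \<le> B * sqrt (2 * \<epsilon>)" .
        have "\<bar>poly (legendre_poly (Suc n)) t\<bar> \<le> B * sqrt (t - \<xi> + 1 / real (Suc n))"
          using n t' by (intro B) auto
        also have "\<dots> \<le> B * sqrt (2 * \<epsilon>)"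
          using t B(1) \<epsilon>(3) by (intro mult_left_mono real_sqrt_le_mono) auto
        finally have P2: "\<bar>poly (legendre_poly (Suc n)) t\<bar> \<le> B * sqrt (2 * \<epsilon>)" .
        have "\<bar>(x - t) * legendre_kernel n x t\<bar> \<le>
            real (Suc n) / 2 * (\<rho> * (B * sqrt (2 * \<epsilon>)) + \<rho> * (B * sqrt (2 * \<epsilon>)))"
          unfolding christoffel_darboux abs_mult using \<rho> \<rho>0 P1 P2
          by (intro mult_mono order_trans[OF abs_triangle_ineq4 add_mono])
            (auto simp: abs_mult intro!: mult_mono)
        then have "\<bar>(x - t) * legendre_kernel n x t\<bar> * \<bar>H 0 t\<bar> \<le>
            real (Suc n) / 2 * (2 * \<rho> * (B * sqrt (2 * \<epsilon>))) * (C * (t - \<xi>) powr \<beta>)"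
          using C(2)[OF t'(1)] B(1) \<rho>0 \<epsilon>(1) by (intro mult_mono) (auto simp: mult_ac)
        then show ?thesis
          using q[OF t'(1)] by (simp add: abs_mult mult_ac)
      qed
    qed
    also have "\<dots> = ?c * (\<epsilon> powr (\<beta> + 1) / (\<beta> + 1))"
      using has_integral_powr_left[OF \<epsilon>(1) \<beta>] by (intro integral_unique has_integral_mult_right) auto
    also have "\<dots> \<le> 2 * real n / 2 * (2 * \<rho> * (B * sqrt (2 * \<epsilon>))) * C * (\<epsilon> powr (\<beta> + 1) / (\<beta> + 1))"
      using n1 \<rho>0 B(1) C(1) \<beta> \<epsilon> by (intro mult_right_mono) auto
    also have "\<dots> = 2 * (C * B * sqrt 2) / (\<beta> + 1) * \<rho> * (real n * (\<epsilon> powr (1 / 2) * \<epsilon> powr (\<beta> + 1)))"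
      using \<epsilon>(1) unfolding real_sqrt_mult by (simp add: powr_half_sqrt)
    also have "real n * (\<epsilon> powr (1 / 2) * \<epsilon> powr (\<beta> + 1)) = real n powr (- \<beta> - 1 / 2)"
      unfolding \<epsilon>(4) powr_powr powr_add[symmetric] powr_mult_base[OF of_nat_0_le_iff]
      by (intro arg_cong[where f = "(powr) (real n)"]) (simp add: field_simps)
    finally have 1: "\<bar>integral {\<xi>..\<xi> + \<epsilon>} (\<lambda>t. q t * legendre_kernel n x t)\<bar> \<le>
      2 * (C * B * sqrt 2) / (\<beta> + 1) * \<rho> * real n powr (- \<beta> - 1 / 2)"
      by simp
    have sub: "{\<xi> + \<epsilon>..1} \<subseteq> {\<xi><..1}"
      using \<epsilon>(1) by auto
    then have contH: "continuous_on {\<xi> + \<epsilon>..1} (H 0)"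
      by (rule continuous_on_subset[OF singular_derivs_continuous[OF H]])
    have "integral {\<xi> + \<epsilon>..1} (\<lambda>t. q t * legendre_kernel n x t) =
        integral {\<xi> + \<epsilon>..1} (\<lambda>t. real (Suc n) / 2 *
        (poly (legendre_poly (Suc n)) x * (H 0 t * poly (legendre_poly n) t)
         - poly (legendre_poly n) x * (H 0 t * poly (legendre_poly (Suc n)) t)))"
      using sub by (intro integral_cong CD) auto
    also have "\<dots> = real (Suc n) / 2 *
        (poly (legendre_poly (Suc n)) x * ?I n - poly (legendre_poly n) x * ?I (Suc n))"
      by (subst integral_mult_right, subst integral_diff)
        (auto intro!: integrable_continuous_real continuous_intros contH)
    finally have "\<bar>integral {\<xi> + \<epsilon>..1} (\<lambda>t. q t * legendre_kernel n x t)\<bar> =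
        real (Suc n) / 2 * \<bar>poly (legendre_poly (Suc n)) x * ?I n - poly (legendre_poly n) x * ?I (Suc n)\<bar>"
      by (simp only: abs_mult)
    also have "\<dots> \<le> (2 * real n) / 2 * (\<rho> * (D * \<epsilon> powr (\<beta> + 3 / 2)) + \<rho> * (D * \<epsilon> powr (\<beta> + 3 / 2)))"
    proof (intro mult_mono order_trans[OF abs_triangle_ineq4 add_mono])
      show "\<bar>poly (legendre_poly (Suc n)) x * ?I n\<bar> \<le> \<rho> * (D * \<epsilon> powr (\<beta> + 3 / 2))"
        unfolding abs_mult using \<rho> \<rho>0 n \<epsilon> by (intro mult_mono D) (auto simp: \<epsilon>_def)
      \<comment> \<open>The cut 1/n is also admissible for index n + 1, because
        \<open>singular_integral_bound\<close> allows every \<epsilon> \<ge> 1/(n + 1).\<close>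
      show "\<bar>poly (legendre_poly n) x * ?I (Suc n)\<bar> \<le> \<rho> * (D * \<epsilon> powr (\<beta> + 3 / 2))"
        unfolding abs_mult using \<rho> \<rho>0 n \<epsilon> by (intro mult_mono D) auto
    qed (use n1 in auto)
    also have "\<dots> = 2 * D * \<rho> * (real n * \<epsilon> powr (\<beta> + 3 / 2))"
      by simp
    also have "real n * \<epsilon> powr (\<beta> + 3 / 2) = real n powr (- \<beta> - 1 / 2)"
      unfolding \<epsilon>(4) powr_powr powr_mult_base[OF of_nat_0_le_iff]
      by (intro arg_cong[where f = "(powr) (real n)"]) (simp add: field_simps)
    finally have 2: "\<bar>integral {\<xi> + \<epsilon>..1} (\<lambda>t. q t * legendre_kernel n x t)\<bar> \<le>
        2 * D * \<rho> * real n powr (- \<beta> - 1 / 2)" .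
    have "integral {\<xi>..1} (\<lambda>t. q t * legendre_kernel n x t) =
        integral {\<xi>..\<xi> + \<epsilon>} (\<lambda>t. q t * legendre_kernel n x t) +
        integral {\<xi> + \<epsilon>..1} (\<lambda>t. q t * legendre_kernel n x t)"
      using \<epsilon> by (intro Henstock_Kurzweil_Integration.integral_combine[symmetric]
          integrable_continuous_real continuous_intros contq) auto
    then have "\<bar>integral {\<xi>..1} (\<lambda>t. q t * legendre_kernel n x t)\<bar> \<le>
        2 * (C * B * sqrt 2) / (\<beta> + 1) * \<rho> * real n powr (- \<beta> - 1 / 2) +
        2 * D * \<rho> * real n powr (- \<beta> - 1 / 2)"
      using 1 2 by linarith
    then show ?thesis by (simp add: algebra_simps)
  qed
  then have "\<forall>\<^sub>F n in sequentially. \<forall>\<rho>.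
    \<bar>poly (legendre_poly n) x\<bar> \<le> \<rho> \<longrightarrow> \<bar>poly (legendre_poly (Suc n)) x\<bar> \<le> \<rho> \<longrightarrow>
    \<bar>integral {\<xi>..1} (\<lambda>t. q t * legendre_kernel n x t)\<bar> \<le> ?E * \<rho> * real n powr (- \<beta> - 1 / 2)"
    by (intro eventually_mono[OF ev]) blast
  moreover have "?E \<ge> 0" using B(1) C(1) D(1) \<beta> by simp
  ultimately show ?thesis by blast
qed

section \<open>Division by \<open>x - t\<close>\<close>

text \<open>The \<open>k\<close>-th derivative of \<open>(t - \<xi>)\<^sup>\<beta> G\<^sub>0\<close> is \<open>(t - \<xi>)\<^sup>\<beta>\<^sup>-\<^sup>k\<close> times the factor with indices \<open>k\<close> and \<open>0\<close>; the
  index \<open>j\<close> counts derivatives of that factor.\<close>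

primrec powr_factor :: "real \<Rightarrow> real \<Rightarrow> (nat \<Rightarrow> real \<Rightarrow> real) \<Rightarrow> nat \<Rightarrow> nat \<Rightarrow> real \<Rightarrow> real" where
  "powr_factor \<xi> \<beta> G 0 j t = G j t"
| "powr_factor \<xi> \<beta> G (Suc k) j t = (\<beta> - real k + real j) * powr_factor \<xi> \<beta> G k j t
     + (t - \<xi>) * powr_factor \<xi> \<beta> G k (Suc j) t"

text \<open>Differentiating the factor t - \<xi> contributes one more copy of the next derivative;
  the summand \<open>real j\<close> in the recursion accounts for it.\<close>

lemma DERIV_powr_factor:
  assumes "\<And>j. (G j has_real_derivative G (Suc j) t) (at t within S)"
  shows "(powr_factor \<xi> \<beta> G k j has_real_derivative powr_factor \<xi> \<beta> G k (Suc j) t) (at t within S)"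
proof (induction k arbitrary: j)
  case 0
  then show ?case using assms by simp
next
  case (Suc k)
  have "((\<lambda>t. (\<beta> - real k + real j) * powr_factor \<xi> \<beta> G k j t
     + (t - \<xi>) * powr_factor \<xi> \<beta> G k (Suc j) t) has_real_derivative
     (\<beta> - real k + real j) * powr_factor \<xi> \<beta> G k (Suc j) t
     + (powr_factor \<xi> \<beta> G k (Suc j) t + (t - \<xi>) * powr_factor \<xi> \<beta> G k (Suc (Suc j)) t)) (at t within S)"
    by (auto intro!: derivative_eq_intros Suc)
  then show ?case by (simp add: algebra_simps)
qed

lemma continuous_bounded_on_Icc:
  fixes f :: "real \<Rightarrow> real"
  assumes "continuous_on {a..b} f"
  shows "\<exists>C\<ge>0. \<forall>t\<in>{a..b}. \<bar>f t\<bar> \<le> C"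
proof -
  have "bounded (f ` {a..b})"
    by (intro compact_imp_bounded compact_continuous_image assms) simp
  then obtain C where "C > 0" "\<And>t. t \<in> {a..b} \<Longrightarrow> \<bar>f t\<bar> \<le> C"
    unfolding bounded_pos by auto
  then show ?thesis by (intro exI[of _ C]) auto
qed

text \<open>After the power is split off, the remaining factor is continuous on the compact interval
  [\<xi>, 1], hence bounded.\<close>

lemma singular_derivs_powr_mult:
  assumes G: "\<And>k t. t \<in> {\<xi>..1} \<Longrightarrow> (G k has_real_derivative G (Suc k) t) (at t within {\<xi>..1})"
  shows "\<exists>H. singular_derivs \<xi> \<beta> H \<and> (\<forall>t. H 0 t = (t - \<xi>) powr \<beta> * G 0 t)"
proof (intro exI[of _ "\<lambda>k t. (t - \<xi>) powr (\<beta> - real k) * powr_factor \<xi> \<beta> G k 0 t"] conjI)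
  show "singular_derivs \<xi> \<beta> (\<lambda>k t. (t - \<xi>) powr (\<beta> - real k) * powr_factor \<xi> \<beta> G k 0 t)"
    unfolding singular_derivs_def
  proof (intro allI conjI ballI)
    fix k t assume t: "t \<in> {\<xi><..1}"
    have d: "(powr_factor \<xi> \<beta> G k 0 has_real_derivative powr_factor \<xi> \<beta> G k (Suc 0) t) (at t within {\<xi><..1})"
      using t by (intro has_field_derivative_subset[OF DERIV_powr_factor[where G = G, OF G]]) auto
    have "((\<lambda>t. (t - \<xi>) powr (\<beta> - real k) * powr_factor \<xi> \<beta> G k 0 t) has_real_derivative
        (\<beta> - real k) * (t - \<xi>) powr (\<beta> - real k - 1) * powr_factor \<xi> \<beta> G k 0 t
        + (t - \<xi>) powr (\<beta> - real k) * powr_factor \<xi> \<beta> G k (Suc 0) t) (at t within {\<xi><..1})"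
      using t by (auto intro!: derivative_eq_intros d)
    moreover have "(t - \<xi>) powr (\<beta> - real k) = (t - \<xi>) powr (\<beta> - real k - 1) * (t - \<xi>)"
      using t powr_add[of "t - \<xi>" "\<beta> - real k - 1" 1] by simp
    moreover have "\<beta> - real (Suc k) = \<beta> - real k - 1" by simp
    ultimately show "((\<lambda>t. (t - \<xi>) powr (\<beta> - real k) * powr_factor \<xi> \<beta> G k 0 t) has_real_derivative
        (t - \<xi>) powr (\<beta> - real (Suc k)) * powr_factor \<xi> \<beta> G (Suc k) 0 t) (at t within {\<xi><..1})"
      by (simp add: algebra_simps)
  next
    fix k
    have "continuous_on {\<xi>..1} (powr_factor \<xi> \<beta> G k 0)"
      using DERIV_powr_factor[where G = G, OF G] DERIV_continuous_on by blast
    from continuous_bounded_on_Icc[OF this] obtain C where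
      "C \<ge> 0" "\<And>t. t \<in> {\<xi>..1} \<Longrightarrow> \<bar>powr_factor \<xi> \<beta> G k 0 t\<bar> \<le> C"
      by blast
    then show "\<exists>C\<ge>0. \<forall>t\<in>{\<xi><..1}. \<bar>(t - \<xi>) powr (\<beta> - real k) * powr_factor \<xi> \<beta> G k 0 t\<bar>
        \<le> C * (t - \<xi>) powr (\<beta> - real k)"
      by (intro exI[of _ C]) (auto simp: abs_mult mult.commute[of C] intro!: mult_left_mono)
  qed
qed simp

text \<open>Since t - \<xi> < 2, the surplus power (t - \<xi>)^(\<gamma> - \<beta>) is at most
  2^(\<gamma> - \<beta>).\<close>

lemma singular_derivs_diff_cmult:
  assumes Q: "singular_derivs \<xi> \<beta> Q" and R: "singular_derivs \<xi> \<gamma> R" and "\<beta> \<le> \<gamma>" "-1 < \<xi>"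
  shows "singular_derivs \<xi> \<beta> (\<lambda>k t. Q k t - c * R k t)"
  unfolding singular_derivs_def
proof (intro allI conjI ballI)
  fix k t assume "t \<in> {\<xi><..1}"
  then show "((\<lambda>t. Q k t - c * R k t) has_real_derivative Q (Suc k) t - c * R (Suc k) t) (at t within {\<xi><..1})"
    by (intro DERIV_diff DERIV_cmult singular_derivsD(1)[OF Q] singular_derivsD(1)[OF R])
next
  fix k
  obtain C where C: "C \<ge> 0" "\<And>t. t \<in> {\<xi><..1} \<Longrightarrow> \<bar>Q k t\<bar> \<le> C * (t - \<xi>) powr (\<beta> - real k)"
    using singular_derivsD(2)[OF Q, of k] by auto
  obtain D where D: "D \<ge> 0" "\<And>t. t \<in> {\<xi><..1} \<Longrightarrow> \<bar>R k t\<bar> \<le> D * (t - \<xi>) powr (\<gamma> - real k)"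
    using singular_derivsD(2)[OF R, of k] by auto
  have "\<bar>Q k t - c * R k t\<bar> \<le> (C + \<bar>c\<bar> * (D * 2 powr (\<gamma> - \<beta>))) * (t - \<xi>) powr (\<beta> - real k)"
    if t: "t \<in> {\<xi><..1}" for t
  proof -
    have "\<bar>R k t\<bar> \<le> D * (t - \<xi>) powr (\<gamma> - real k)"
      by (rule D(2)[OF t])
    also have "(t - \<xi>) powr (\<gamma> - real k) = (t - \<xi>) powr (\<gamma> - \<beta>) * (t - \<xi>) powr (\<beta> - real k)"
      by (simp add: powr_add[symmetric])
    also have "D * \<dots> \<le> D * (2 powr (\<gamma> - \<beta>) * (t - \<xi>) powr (\<beta> - real k))"
      using t assms D(1) by (intro mult_left_mono mult_right_mono powr_mono2) auto
    finally have "\<bar>c\<bar> * \<bar>R k t\<bar> \<le> \<bar>c\<bar> * (D * (2 powr (\<gamma> - \<beta>) * (t - \<xi>) powr (\<beta> - real k)))"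
      by (intro mult_left_mono) auto
    moreover have "\<bar>Q k t - c * R k t\<bar> \<le> \<bar>Q k t\<bar> + \<bar>c\<bar> * \<bar>R k t\<bar>"
      using abs_triangle_ineq4[of "Q k t" "c * R k t"] by (simp add: abs_mult)
    ultimately show ?thesis
      using C(2)[OF t] by (simp add: algebra_simps)
  qed
  then show "\<exists>C\<ge>0. \<forall>t\<in>{\<xi><..1}. \<bar>Q k t - c * R k t\<bar> \<le> C * (t - \<xi>) powr (\<beta> - real k)"
    using C(1) D(1) by (intro exI[of _ "C + \<bar>c\<bar> * (D * 2 powr (\<gamma> - \<beta>))"]) auto
qed

text \<open>\<open>H0\<close> and \<open>HS\<close> are the Leibniz relations for (x - t) H = Q. On
  a set at distance at least d from x they can be solved for the highest derivative, which bounds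
  all derivatives inductively.\<close>

lemma quotient_derivs_bound:
  assumes Q: "singular_derivs \<xi> \<beta> Q" and "-1 < \<xi>" and T: "T \<subseteq> {\<xi><..1}"
    and d: "d > 0" "\<And>t. t \<in> T \<Longrightarrow> d \<le> \<bar>x - t\<bar>"
    and H0: "\<And>t. t \<in> T \<Longrightarrow> (x - t) * H 0 t = Q 0 t"
    and HS: "\<And>k t. t \<in> T \<Longrightarrow> (x - t) * H (Suc k) t = Q (Suc k) t + real (Suc k) * H k t"
  shows "\<exists>C\<ge>0. \<forall>t\<in>T. \<bar>H k t\<bar> \<le> C * (t - \<xi>) powr (\<beta> - real k)"
proof (induction k)
  case 0
  obtain C where C: "C \<ge> 0" "\<And>t. t \<in> {\<xi><..1} \<Longrightarrow> \<bar>Q 0 t\<bar> \<le> C * (t - \<xi>) powr \<beta>"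
    using singular_derivsD(2)[OF Q, of 0] by auto
  have "\<bar>H 0 t\<bar> \<le> C / d * (t - \<xi>) powr \<beta>" if t: "t \<in> T" for t
  proof -
    have "d * \<bar>H 0 t\<bar> \<le> \<bar>x - t\<bar> * \<bar>H 0 t\<bar>"
      using d(2)[OF t] by (intro mult_right_mono) auto
    also have "\<dots> \<le> C * (t - \<xi>) powr \<beta>"
      using H0[OF t] C(2)[of t] t T by (auto simp flip: abs_mult)
    finally have "\<bar>H 0 t\<bar> \<le> C * (t - \<xi>) powr \<beta> / d"
      unfolding pos_le_divide_eq[OF d(1)] by (simp only: mult.commute)
    then show ?thesis by (simp only: times_divide_eq_left)
  qed
  then show ?case using C(1) d(1) by (intro exI[of _ "C / d"]) auto
next
  case (Suc k)
  then obtain D where D: "D \<ge> 0" "\<And>t. t \<in> T \<Longrightarrow> \<bar>H k t\<bar> \<le> D * (t - \<xi>) powr (\<beta> - real k)"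
    by blast
  obtain C where C: "C \<ge> 0" "\<And>t. t \<in> {\<xi><..1} \<Longrightarrow> \<bar>Q (Suc k) t\<bar> \<le> C * (t - \<xi>) powr (\<beta> - real (Suc k))"
    using singular_derivsD(2)[OF Q, of "Suc k"] by auto
  let ?E = "C + real (Suc k) * (D * 2)"
  have "\<bar>H (Suc k) t\<bar> \<le> ?E / d * (t - \<xi>) powr (\<beta> - real (Suc k))" if t: "t \<in> T" for t
  proof -
    have t': "t \<in> {\<xi><..1}" using t T by auto
    have "\<bar>H k t\<bar> \<le> D * (t - \<xi>) powr (\<beta> - real k)"
      by (rule D(2)[OF t])
    \<comment> \<open>The previous derivative is less singular by one power of t - \<xi>, and that
      power is bounded by 2.\<close>
    also have "(t - \<xi>) powr (\<beta> - real k) = (t - \<xi>) * (t - \<xi>) powr (\<beta> - real (Suc k))"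
      using t' by (simp add: powr_mult_base)
    also have "D * \<dots> \<le> D * (2 * (t - \<xi>) powr (\<beta> - real (Suc k)))"
      using t' \<open>-1 < \<xi>\<close> D(1) by (intro mult_left_mono mult_right_mono) auto
    finally have 1: "real (Suc k) * \<bar>H k t\<bar> \<le> real (Suc k) * (D * (2 * (t - \<xi>) powr (\<beta> - real (Suc k))))"
      by (intro mult_left_mono) auto
    have "d * \<bar>H (Suc k) t\<bar> \<le> \<bar>x - t\<bar> * \<bar>H (Suc k) t\<bar>"
      using d(2)[OF t] by (intro mult_right_mono) auto
    also have "\<dots> = \<bar>Q (Suc k) t + real (Suc k) * H k t\<bar>"
      using HS[OF t] by (simp only: flip: abs_mult)
    also have "\<dots> \<le> \<bar>Q (Suc k) t\<bar> + real (Suc k) * \<bar>H k t\<bar>"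
      by (rule order_trans[OF abs_triangle_ineq]) (simp add: abs_mult)
    also have "\<dots> \<le> C * (t - \<xi>) powr (\<beta> - real (Suc k)) +
        real (Suc k) * (D * (2 * (t - \<xi>) powr (\<beta> - real (Suc k))))"
      by (rule add_mono[OF C(2)[OF t'] 1])
    also have "\<dots> = ?E * (t - \<xi>) powr (\<beta> - real (Suc k))"
      by (simp only: distrib_right mult.assoc)
    finally have "\<bar>H (Suc k) t\<bar> \<le> ?E * (t - \<xi>) powr (\<beta> - real (Suc k)) / d"
      unfolding pos_le_divide_eq[OF d(1)] by (simp only: mult.commute)
    then show ?thesis by (simp only: times_divide_eq_left)
  qed
  then show ?case using C(1) D(1) d(1) by (intro exI[of _ "?E / d"]) auto
qed

text \<open>The Leibniz relation for (x - t) H = Q solved for the highest derivative; it describes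
  derivatives only for t different from x.\<close>

primrec quotient_derivs :: "real \<Rightarrow> (nat \<Rightarrow> real \<Rightarrow> real) \<Rightarrow> nat \<Rightarrow> real \<Rightarrow> real" where
  "quotient_derivs x Q 0 t = Q 0 t / (x - t)"
| "quotient_derivs x Q (Suc k) t = (Q (Suc k) t + real (Suc k) * quotient_derivs x Q k t) / (x - t)"

lemma DERIV_quotient_derivs:
  assumes "\<And>k. (Q k has_real_derivative Q (Suc k) t) (at t within S)" "t \<noteq> x"
  shows "(quotient_derivs x Q k has_real_derivative quotient_derivs x Q (Suc k) t) (at t within S)"
proof (induction k)
  case 0
  have "((\<lambda>t. Q 0 t / (x - t)) has_real_derivative
      (Q (Suc 0) t * (x - t) + Q 0 t) / ((x - t) * (x - t))) (at t within S)"
    using assms(2) by (auto intro!: derivative_eq_intros assms(1))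
  also have "(Q (Suc 0) t * (x - t) + Q 0 t) / ((x - t) * (x - t)) = quotient_derivs x Q (Suc 0) t"
    using assms(2) by (simp add: divide_simps)
  finally show ?case by simp
next
  case (Suc k)
  let ?R = "quotient_derivs x Q"
  have "((\<lambda>t. (Q (Suc k) t + real (Suc k) * ?R k t) / (x - t)) has_real_derivative
      ((Q (Suc (Suc k)) t + real (Suc k) * ?R (Suc k) t) * (x - t) + (Q (Suc k) t + real (Suc k) * ?R k t))
        / ((x - t) * (x - t))) (at t within S)"
    using assms(2) by (auto intro!: derivative_eq_intros assms(1) Suc simp del: of_nat_Suc quotient_derivs.simps)
  moreover have e: "Q (Suc k) t + real (Suc k) * ?R k t = ?R (Suc k) t * (x - t)"
    using assms(2) by simp
  have "((Q (Suc (Suc k)) t + real (Suc k) * ?R (Suc k) t) * (x - t) + (Q (Suc k) t + real (Suc k) * ?R k t))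
      = (Q (Suc (Suc k)) t + real (Suc (Suc k)) * ?R (Suc k) t) * (x - t)"
    unfolding e by (simp add: algebra_simps del: quotient_derivs.simps)
  ultimately show ?case using assms(2) by (simp del: of_nat_Suc add: quotient_derivs.simps(2)[abs_def])
qed

lemma singular_derivs_divide_left:
  assumes Q: "singular_derivs \<xi> \<beta> Q" and "-1 < \<xi>" "x < \<xi>"
  shows "singular_derivs \<xi> \<beta> (quotient_derivs x Q)"
  unfolding singular_derivs_def
proof (intro allI conjI ballI)
  fix k t assume "t \<in> {\<xi><..1}"
  with assms show "(quotient_derivs x Q k has_real_derivative quotient_derivs x Q (Suc k) t) (at t within {\<xi><..1})"
    by (intro DERIV_quotient_derivs singular_derivsD(1)[OF Q]) auto
next
  fix k
  show "\<exists>C\<ge>0. \<forall>t\<in>{\<xi><..1}. \<bar>quotient_derivs x Q k t\<bar> \<le> C * (t - \<xi>) powr (\<beta> - real k)"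
    using assms by (intro quotient_derivs_bound[OF Q \<open>-1 < \<xi>\<close>, of _ "\<xi> - x" x]) auto
qed

text \<open>Hadamard's integral form of the quotient \<open>Q / (x - t)\<close> shows that it is smooth also at \<open>x\<close>.\<close>

lemma singular_derivs_divide_interior:
  assumes Q: "singular_derivs \<xi> \<beta> Q" and "-1 < \<xi>" and x: "\<xi> < x" "x \<le> 1" and Qx: "Q 0 x = 0"
  defines "H \<equiv> \<lambda>k t. - integral {0..1} (\<lambda>s. s ^ k * Q (Suc k) (x + s * (t - x)))"
  shows "singular_derivs \<xi> \<beta> H"
    and "\<And>t. t \<in> {\<xi><..1} \<Longrightarrow> (x - t) * H 0 t = Q 0 t"
proof -
  \<comment> \<open>By convexity the segment from x to t stays in the domain of Q.\<close>
  have in_dom: "x + s * (t - x) \<in> {\<xi><..1}" if "s \<in> {0..1}" "t \<in> {\<xi><..1}" for s t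
    using convexD_alt[of "{\<xi><..1}" x t s] that x by (simp add: algebra_simps)
  have dQ: "((\<lambda>t. Q k (x + s * (t - x))) has_real_derivative Q (Suc k) (x + s * (t - x)) * s) (at t within {\<xi><..1})"
    if "s \<in> {0..1}" "t \<in> {\<xi><..1}" for s t k
  proof -
    have "(Q k has_real_derivative Q (Suc k) (x + s * (t - x)))
        (at (x + s * (t - x)) within (\<lambda>t. x + s * (t - x)) ` {\<xi><..1})"
      using in_dom that by (intro has_field_derivative_subset[OF singular_derivsD(1)[OF Q]]) auto
    moreover have "((\<lambda>t. x + s * (t - x)) has_real_derivative s) (at t within {\<xi><..1})"
      by (auto intro!: derivative_eq_intros)
    ultimately show ?thesis
      by (rule DERIV_image_chain[unfolded o_def])
  qed
  have dQ': "((\<lambda>s. Q 0 (x + s * (t - x))) has_real_derivative Q (Suc 0) (x + s * (t - x)) * (t - x)) (at s within {0..1})"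
    if "s \<in> {0..1}" "t \<in> {\<xi><..1}" for s t
  proof -
    have "(Q 0 has_real_derivative Q (Suc 0) (x + s * (t - x)))
        (at (x + s * (t - x)) within (\<lambda>s. x + s * (t - x)) ` {0..1})"
      using in_dom that by (intro has_field_derivative_subset[OF singular_derivsD(1)[OF Q]]) auto
    moreover have "((\<lambda>s. x + s * (t - x)) has_real_derivative t - x) (at s within {0..1})"
      by (auto intro!: derivative_eq_intros)
    ultimately show ?thesis
      by (rule DERIV_image_chain[unfolded o_def])
  qed
  have contQ: "continuous_on ({\<xi><..1} \<times> {0..1}) (\<lambda>(t, s). s ^ j * Q k (x + s * (t - x)))" for j k
    unfolding case_prod_beta
    by (intro continuous_intros continuous_on_compose2[OF singular_derivs_continuous[OF Q, of k]])
      (use in_dom in auto)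
  have contQ': "continuous_on {0..1} (\<lambda>s. s ^ j * Q k (x + s * (t - x)))" if "t \<in> {\<xi><..1}" for j k t
    by (intro continuous_intros continuous_on_compose2[OF singular_derivs_continuous[OF Q, of k]])
      (use in_dom that in auto)
  \<comment> \<open>Differentiation under the integral sign; the chain rule supplies the additional
    factor s.\<close>
  have dH: "(H k has_real_derivative H (Suc k) t) (at t within {\<xi><..1})" if t: "t \<in> {\<xi><..1}" for k t
    unfolding H_def
  proof (rule DERIV_minus)
    show "((\<lambda>t. integral {0..1} (\<lambda>s. s ^ k * Q (Suc k) (x + s * (t - x)))) has_real_derivative
        integral {0..1} (\<lambda>s. s ^ Suc k * Q (Suc (Suc k)) (x + s * (t - x)))) (at t within {\<xi><..1})"
      unfolding interval_cbox
    proof (rule leibniz_rule_field_derivative)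
      fix t s :: real assume ts: "t \<in> {\<xi><..1}" "s \<in> cbox 0 1"
      then have "((\<lambda>t. s ^ k * Q (Suc k) (x + s * (t - x))) has_real_derivative
          s ^ k * (Q (Suc (Suc k)) (x + s * (t - x)) * s)) (at t within {\<xi><..1})"
        by (intro DERIV_cmult dQ) auto
      then show "((\<lambda>t. s ^ k * Q (Suc k) (x + s * (t - x))) has_real_derivative
          s ^ Suc k * Q (Suc (Suc k)) (x + s * (t - x))) (at t within {\<xi><..1})"
        by (simp add: mult_ac)
    next
      fix t :: real assume "t \<in> {\<xi><..1}"
      then show "(\<lambda>s. s ^ k * Q (Suc k) (x + s * (t - x))) integrable_on cbox 0 1"
        unfolding interval_cbox[symmetric] by (intro integrable_continuous_real contQ')
    next
      show "continuous_on ({\<xi><..1} \<times> cbox 0 1) (\<lambda>(t, s). s ^ Suc k * Q (Suc (Suc k)) (x + s * (t - x)))"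
        unfolding interval_cbox[symmetric] by (rule contQ)
    qed (use t in auto)
  qed
  show H0: "(x - t) * H 0 t = Q 0 t" if t: "t \<in> {\<xi><..1}" for t
  proof -
    \<comment> \<open>Fundamental theorem along the segment from x to t; the value of Q at x is 0 by
      \<open>Qx\<close>.\<close>
    have "((\<lambda>s. Q (Suc 0) (x + s * (t - x)) * (t - x)) has_integral
        (Q 0 (x + 1 * (t - x)) - Q 0 (x + 0 * (t - x)))) {0..1}"
      using dQ'[OF _ t]
      by (intro fundamental_theorem_of_calculus)
        (auto simp flip: has_real_derivative_iff_has_vector_derivative)
    then have "integral {0..1} (\<lambda>s. Q (Suc 0) (x + s * (t - x)) * (t - x)) =
        Q 0 (x + 1 * (t - x)) - Q 0 (x + 0 * (t - x))"
      by (rule integral_unique)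
    then have "integral {0..1} (\<lambda>s. Q (Suc 0) (x + s * (t - x))) * (t - x) =
        Q 0 (x + 1 * (t - x)) - Q 0 (x + 0 * (t - x))"
      by (simp only: integral_mult_left)
    moreover have "H 0 t = - integral {0..1} (\<lambda>s. Q (Suc 0) (x + s * (t - x)))"
      by (simp add: H_def)
    moreover have "Q 0 (x + 1 * (t - x)) - Q 0 (x + 0 * (t - x)) = Q 0 t"
      using Qx by simp
    ultimately show ?thesis by algebra
  qed
  \<comment> \<open>Each Leibniz relation is the derivative of the previous one, whose left side
    vanishes identically on an open interval. For k = 0 the truncated index \<open>k - 1\<close> is
    harmless, since its coefficient is 0.\<close>
  have HR: "(x - t) * H k t - real k * H (k - 1) t - Q k t = 0" if "t \<in> {\<xi><..<1}" for k t
    using that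
  proof (induction k arbitrary: t)
    case 0
    then show ?case using H0[of t] by simp
  next
    case (Suc k)
    have at: "at t within {\<xi><..1} = at t"
      using Suc.prems by (intro at_within_nhd[of t "{\<xi><..<1}"]) auto
    have t: "t \<in> {\<xi><..1}" using Suc.prems by auto
    have dk: "((\<lambda>t. real k * H (k - 1) t) has_real_derivative real k * H k t) (at t)"
      using dH[OF t, of "k - 1"] unfolding at by (cases k) (auto intro!: derivative_eq_intros)
    have "((\<lambda>t. (x - t) * H k t - real k * H (k - 1) t - Q k t) has_real_derivative
        ((x - t) * H (Suc k) t - H k t) - real k * H k t - Q (Suc k) t) (at t)"
    proof (intro DERIV_diff dk)
      show "((\<lambda>t. (x - t) * H k t) has_real_derivative (x - t) * H (Suc k) t - H k t) (at t)"
        using dH[OF t, of k] unfolding at by (auto intro!: derivative_eq_intros)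
      show "(Q k has_real_derivative Q (Suc k) t) (at t)"
        using singular_derivsD(1)[OF Q t, of k] unfolding at .
    qed
    moreover have "((\<lambda>t. (x - t) * H k t - real k * H (k - 1) t - Q k t) has_real_derivative 0) (at t)"
    proof (rule has_field_derivative_transform_within_open[of "\<lambda>_. 0" _ _ "{\<xi><..<1}"])
      show "0 = (x - y) * H k y - real k * H (k - 1) y - Q k y" if "y \<in> {\<xi><..<1}" for y
        by (rule Suc.IH[OF that, symmetric])
    qed (use Suc.prems in auto)
    ultimately have "((x - t) * H (Suc k) t - H k t) - real k * H k t - Q (Suc k) t = 0"
      by (rule DERIV_unique)
    then show ?case by (simp add: algebra_simps)
  qed
  \<comment> \<open>Left of the midpoint \<open>m\<close> the distance to x is at least x - m and
    the Leibniz relations give the bound; on [m, 1], away from \<xi>, compactness does.\<close>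
  define m where "m = (\<xi> + x) / 2"
  have m: "\<xi> < m" "m < x" using x by (auto simp: m_def)
  show "singular_derivs \<xi> \<beta> H"
    unfolding singular_derivs_def
  proof (intro allI conjI ballI dH)
    fix k
    have "\<exists>C\<ge>0. \<forall>t\<in>{\<xi><..<m}. \<bar>H k t\<bar> \<le> C * (t - \<xi>) powr (\<beta> - real k)"
    proof (rule quotient_derivs_bound[OF Q \<open>-1 < \<xi>\<close>, of _ "x - m" x])
      fix t j assume "t \<in> {\<xi><..<m}"
      then show "(x - t) * H (Suc j) t = Q (Suc j) t + real (Suc j) * H j t"
        using HR[of t "Suc j"] m x by simp
    qed (use m x H0 in auto)
    then obtain C where C: "C \<ge> 0" "\<And>t. t \<in> {\<xi><..<m} \<Longrightarrow> \<bar>H k t\<bar> \<le> C * (t - \<xi>) powr (\<beta> - real k)"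
      by blast
    have "continuous_on {\<xi><..1} (H k)"
      using dH DERIV_continuous_on by blast
    then have "continuous_on {m..1} (\<lambda>t. H k t * (t - \<xi>) powr (real k - \<beta>))"
      using m by (intro continuous_intros) (auto elim: continuous_on_subset)
    from continuous_bounded_on_Icc[OF this] obtain D where
      D: "D \<ge> 0" "\<And>t. t \<in> {m..1} \<Longrightarrow> \<bar>H k t * (t - \<xi>) powr (real k - \<beta>)\<bar> \<le> D"
      by blast
    have "\<bar>H k t\<bar> \<le> max C D * (t - \<xi>) powr (\<beta> - real k)" if t: "t \<in> {\<xi><..1}" for t
    proof (cases "t < m")
      case True
      then have "\<bar>H k t\<bar> \<le> C * (t - \<xi>) powr (\<beta> - real k)"
        using t by (intro C) auto
      also have "\<dots> \<le> max C D * (t - \<xi>) powr (\<beta> - real k)"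
        by (intro mult_right_mono) auto
      finally show ?thesis .
    next
      case False
      have "H k t = (H k t * (t - \<xi>) powr (real k - \<beta>)) * (t - \<xi>) powr (\<beta> - real k)"
        using t by (simp add: mult.assoc powr_add[symmetric])
      then have "\<bar>H k t\<bar> = \<bar>H k t * (t - \<xi>) powr (real k - \<beta>)\<bar> * (t - \<xi>) powr (\<beta> - real k)"
        by (metis abs_mult abs_of_nonneg powr_ge_zero)
      also have "\<dots> \<le> max C D * (t - \<xi>) powr (\<beta> - real k)"
        using D(2)[of t] t False by (intro mult_right_mono) auto
      finally show ?thesis .
    qed
    then show "\<exists>C\<ge>0. \<forall>t\<in>{\<xi><..1}. \<bar>H k t\<bar> \<le> C * (t - \<xi>) powr (\<beta> - real k)"
      using C(1) by (intro exI[of _ "max C D"]) auto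
  qed
qed

lemma singular_derivs_divide:
  assumes "singular_derivs \<xi> \<beta> Q" "-1 < \<xi>" "x \<le> 1" "x \<noteq> \<xi>" "\<xi> < x \<Longrightarrow> Q 0 x = 0"
  shows "\<exists>H. singular_derivs \<xi> \<beta> H \<and> (\<forall>t\<in>{\<xi><..1}. Q 0 t = (x - t) * H 0 t)"
proof (cases "\<xi> < x")
  case True
  note * = singular_derivs_divide_interior[OF assms(1,2) True \<open>x \<le> 1\<close> assms(5)[OF True]]
  show ?thesis
    by (intro exI conjI ballI) (rule *(1), rule *(2)[symmetric])
next
  case False
  then have "x < \<xi>" using assms by simp
  with singular_derivs_divide_left[OF assms(1,2)] show ?thesis
    by (intro exI[of _ "quotient_derivs x Q"]) auto
qed

section \<open>The projection error\<close>

text \<open>If x = \<xi>, dividing by x - t only lowers the exponent by one. Otherwise the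
  subtracted polynomial makes the numerator vanish at a point x right of \<xi>, and N \<ge> \<alpha>
  keeps the exponent \<alpha>.\<close>

lemma one_sided_quotient:
  assumes \<xi>: "\<xi> \<in> {-1<..<1}" and "\<alpha> > 0" and N: "\<alpha> \<le> real N"
    and G: "\<And>k t. t \<in> {\<xi>..1} \<Longrightarrow> (G k has_real_derivative G (Suc k) t) (at t within {\<xi>..1})"
    and x: "x \<le> 1" and c0: "x = \<xi> \<Longrightarrow> c = 0"
    and cx: "\<xi> < x \<Longrightarrow> (x - \<xi>) powr \<alpha> * G 0 x = c * (x - \<xi>) ^ N"
  shows "\<exists>H. singular_derivs \<xi> (if x = \<xi> then \<alpha> - 1 else \<alpha>) H \<and>
    (\<forall>t\<in>{\<xi><..1}. (t - \<xi>) powr \<alpha> * G 0 t - c * (t - \<xi>) ^ N = (x - t) * H 0 t)"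
proof (cases "x = \<xi>")
  case True
  have "\<exists>H. singular_derivs \<xi> (\<alpha> - 1) H \<and> (\<forall>t. H 0 t = (t - \<xi>) powr (\<alpha> - 1) * - G 0 t)"
    by (rule singular_derivs_powr_mult[where G = "\<lambda>k t. - G k t"]) (intro DERIV_minus G)
  then obtain H where H: "singular_derivs \<xi> (\<alpha> - 1) H" "\<And>t. H 0 t = (t - \<xi>) powr (\<alpha> - 1) * - G 0 t"
    by blast
  have "(t - \<xi>) powr \<alpha> * G 0 t - c * (t - \<xi>) ^ N = (x - t) * H 0 t" if "t \<in> {\<xi><..1}" for t
  proof -
    have "(t - \<xi>) powr \<alpha> = (t - \<xi>) * (t - \<xi>) powr (\<alpha> - 1)"
      using that by (simp add: powr_mult_base)
    moreover have "(t - \<xi>) * w * y = (\<xi> - t) * (w * - y)" for w y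
      by (simp add: algebra_simps)
    ultimately show ?thesis
      unfolding H(2) c0[OF True] True by (simp only: mult_zero_left diff_0_right)
  qed
  with H(1) True show ?thesis by auto
next
  case False
  obtain A where A: "singular_derivs \<xi> \<alpha> A" "\<And>t. A 0 t = (t - \<xi>) powr \<alpha> * G 0 t"
    using singular_derivs_powr_mult[where G = G, OF G] by blast
  \<comment> \<open>The power (t - \<xi>)^N is the case of the constant function 1, with all its
    derivatives 0.\<close>
  have "\<exists>P. singular_derivs \<xi> (real N) P \<and> (\<forall>t. P 0 t = (t - \<xi>) powr real N * (if (0::nat) = 0 then 1 else 0))"
    by (rule singular_derivs_powr_mult[where G = "\<lambda>k t. if k = 0 then 1 else 0"]) auto
  then obtain P where P: "singular_derivs \<xi> (real N) P" "\<And>t. P 0 t = (t - \<xi>) powr real N"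
    by auto
  define Q where "Q = (\<lambda>k t. A k t - c * P k t)"
  have Q0: "Q 0 t = (t - \<xi>) powr \<alpha> * G 0 t - c * (t - \<xi>) ^ N" if "\<xi> < t" for t
    using that by (simp add: Q_def A(2) P(2) powr_realpow)
  have "singular_derivs \<xi> \<alpha> Q"
    unfolding Q_def using \<xi> N by (intro singular_derivs_diff_cmult[OF A(1) P(1)]) auto
  moreover have "Q 0 x = 0" if "\<xi> < x"
    using Q0[OF that] cx[OF that] by simp
  ultimately have "\<exists>H. singular_derivs \<xi> \<alpha> H \<and> (\<forall>t\<in>{\<xi><..1}. Q 0 t = (x - t) * H 0 t)"
    using \<xi> x False by (intro singular_derivs_divide) auto
  then show ?thesis using False Q0 by auto
qed

lemma legendre_poly_consecutive_bound:
  assumes "x \<in> {-1..1}"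
  shows "\<exists>B\<ge>0. \<forall>n\<ge>1. \<forall>j\<in>{n, Suc n}. \<bar>poly (legendre_poly j) x\<bar> \<le>
    B * (if x = 1 \<or> x = -1 then 1 else real n powr (- 1 / 2))"
proof (cases "x = 1 \<or> x = -1")
  case True
  then show ?thesis
    using abs_legendre_poly_le_1[OF assms] by (intro exI[of _ 1]) auto
next
  case False
  with assms have "x \<in> {-1<..<1}" by auto
  from legendre_poly_interior_bound[OF this] obtain B where
    B: "B \<ge> 0" "\<And>n. n \<ge> 1 \<Longrightarrow> \<bar>poly (legendre_poly n) x\<bar> \<le> B * sqrt (1 / real n)"
    by blast
  have "\<bar>poly (legendre_poly j) x\<bar> \<le> B * real n powr (- 1 / 2)" if "n \<ge> 1" "j \<in> {n, Suc n}" for n j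
  proof -
    have "\<bar>poly (legendre_poly j) x\<bar> \<le> B * sqrt (1 / real j)"
      using that by (intro B) auto
    also have "\<dots> \<le> B * sqrt (1 / real n)"
      using that B(1) by (intro mult_left_mono real_sqrt_le_mono divide_left_mono) auto
    also have "sqrt (1 / real n) = real n powr (- 1 / 2)"
      using that by (simp add: powr_minus_divide powr_half_sqrt real_sqrt_divide)
    finally show ?thesis .
  qed
  with False B(1) show ?thesis by (intro exI[of _ B]) auto
qed

lemma one_sided_kernel_bound:
  assumes \<xi>: "\<xi> \<in> {-1<..<1}" and \<alpha>: "\<alpha> > 0" and N: "\<alpha> \<le> real N"
    and G: "\<And>k t. t \<in> {\<xi>..1} \<Longrightarrow> (G k has_real_derivative G (Suc k) t) (at t within {\<xi>..1})"
    and x: "x \<in> {-1..1}" and c0: "x = \<xi> \<Longrightarrow> c = 0"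
    and cx: "\<xi> < x \<Longrightarrow> (x - \<xi>) powr \<alpha> * G 0 x = c * (x - \<xi>) ^ N"
  shows "(\<lambda>n. integral {\<xi>..1} (\<lambda>t. ((t - \<xi>) powr \<alpha> * G 0 t - c * (t - \<xi>) ^ N) * legendre_kernel n x t))
    \<in> O(\<lambda>n. if x = \<xi> then real n powr (-\<alpha>)
            else if x = 1 \<or> x = -1 then real n powr (-\<alpha> - 1 / 2)
            else real n powr (-\<alpha> - 1))"
proof -
  define \<beta> where "\<beta> = (if x = \<xi> then \<alpha> - 1 else \<alpha>)"
  define q where "q = (\<lambda>t. (t - \<xi>) powr \<alpha> * G 0 t - c * (t - \<xi>) ^ N)"
  define \<rho> where "\<rho> = (\<lambda>n. if x = 1 \<or> x = -1 then 1 else real n powr (- 1 / 2))"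
  have "\<exists>H. singular_derivs \<xi> \<beta> H \<and> (\<forall>t\<in>{\<xi><..1}. q t = (x - t) * H 0 t)"
    unfolding \<beta>_def q_def using x by (intro one_sided_quotient[OF \<xi> \<alpha> N G _ c0 cx]) auto
  then obtain H where H: "singular_derivs \<xi> \<beta> H" "\<And>t. t \<in> {\<xi><..1} \<Longrightarrow> q t = (x - t) * H 0 t"
    by blast
  \<comment> \<open>Needed for q(\<xi>) = 0, as 0^0 = 1.\<close>
  have "N > 0" using \<alpha> N by (cases N) auto
  have "continuous_on {\<xi>..1} (G 0)"
    using G DERIV_continuous_on by blast
  then have "continuous_on {\<xi>..1} q"
    unfolding q_def using \<alpha> by (intro continuous_intros continuous_on_powr') auto
  moreover have "q \<xi> = 0"
    using \<open>N > 0\<close> by (simp add: q_def)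
  moreover have "\<beta> > -1"
    using \<alpha> by (simp add: \<beta>_def)
  ultimately obtain C where C: "C \<ge> 0" "\<forall>\<^sub>F n in sequentially. \<forall>\<rho>.
    \<bar>poly (legendre_poly n) x\<bar> \<le> \<rho> \<longrightarrow> \<bar>poly (legendre_poly (Suc n)) x\<bar> \<le> \<rho> \<longrightarrow>
    \<bar>integral {\<xi>..1} (\<lambda>t. q t * legendre_kernel n x t)\<bar> \<le> C * \<rho> * real n powr (- \<beta> - 1 / 2)"
    using legendre_kernel_integral_bound[OF \<xi> H(1)] H(2) by blast
  obtain B where B: "B \<ge> 0" "\<And>n j. n \<ge> 1 \<Longrightarrow> j \<in> {n, Suc n} \<Longrightarrow> \<bar>poly (legendre_poly j) x\<bar> \<le> B * \<rho> n"
    using legendre_poly_consecutive_bound[OF x] unfolding \<rho>_def by blast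
  \<comment> \<open>At \<xi>, an interior point, the exponent is -1/2 - (\<alpha> - 1) - 1/2. At
    \<plusminus>1 it is -\<alpha> - 1/2, and elsewhere \<rho> contributes a further -1/2.\<close>
  have rate: "\<rho> n * real n powr (- \<beta> - 1 / 2) = (if x = \<xi> then real n powr (-\<alpha>)
            else if x = 1 \<or> x = -1 then real n powr (-\<alpha> - 1 / 2)
            else real n powr (-\<alpha> - 1))" for n
    using \<xi> by (auto simp: \<rho>_def \<beta>_def powr_add[symmetric] intro!: arg_cong[where f = "(powr) (real n)"])
  have "(\<lambda>n. integral {\<xi>..1} (\<lambda>t. q t * legendre_kernel n x t)) \<in> O(\<lambda>n. \<rho> n * real n powr (- \<beta> - 1 / 2))"
  proof (rule bigoI[of _ "C * B"])
    show "\<forall>\<^sub>F n in sequentially. norm (integral {\<xi>..1} (\<lambda>t. q t * legendre_kernel n x t))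
        \<le> C * B * norm (\<rho> n * real n powr (- \<beta> - 1 / 2))"
      using C(2) eventually_ge_at_top[of 1]
    proof eventually_elim
      case (elim n)
      then have "\<bar>integral {\<xi>..1} (\<lambda>t. q t * legendre_kernel n x t)\<bar>
          \<le> C * (B * \<rho> n) * real n powr (- \<beta> - 1 / 2)"
        using B(2)[of n] by blast
      moreover have "\<rho> n \<ge> 0" by (simp add: \<rho>_def)
      ultimately show ?case by (simp add: mult.assoc)
    qed
  qed
  then show ?thesis unfolding rate unfolding q_def .
qed

section \<open>Orthogonality and the reproducing property\<close>

lemma integral_poly_legendre_primitive:
  assumes "degree r + k < n"
  shows "integral {-1..1} (\<lambda>t. poly r t * poly (legendre_primitive k n) t) = 0"
proof -
  \<comment> \<open>Each integration by parts differentiates r and raises k without boundary terms,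
    until the derivative is 0. Inducting on a bound d for the degree keeps \<open>d + k\<close>
    constant.\<close>
  have "integral {-1..1} (\<lambda>t. poly r t * poly (legendre_primitive k n) t) = 0"
    if "degree r \<le> d" "d + k < n" for d
    using that
  proof (induction d arbitrary: r k)
    case (0 r k)
    have "integral {-1..1} (\<lambda>t. poly r t * poly (legendre_primitive k n) t) =
      - poly r (-1) * poly (legendre_primitive (Suc k) n) (-1)
      - integral {-1..1} (\<lambda>t. poly (pderiv r) t * poly (legendre_primitive (Suc k) n) t)"
      using 0 by (intro integral_by_parts_legendre_primitive continuous_intros)
        (auto intro: has_field_derivative_at_within poly_DERIV)
    moreover have "pderiv r = 0"
      using 0 by (simp add: pderiv_eq_0_iff)
    ultimately show ?case
      using 0 legendre_primitive_at_end[of k n "-1"] by (simp del: legendre_primitive.simps)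
  next
    case (Suc d r k)
    have "integral {-1..1} (\<lambda>t. poly r t * poly (legendre_primitive k n) t) =
      - poly r (-1) * poly (legendre_primitive (Suc k) n) (-1)
      - integral {-1..1} (\<lambda>t. poly (pderiv r) t * poly (legendre_primitive (Suc k) n) t)"
      using Suc.prems by (intro integral_by_parts_legendre_primitive continuous_intros)
        (auto intro: has_field_derivative_at_within poly_DERIV)
    moreover have "integral {-1..1} (\<lambda>t. poly (pderiv r) t * poly (legendre_primitive (Suc k) n) t) = 0"
      using Suc.prems by (intro Suc.IH) (auto simp: degree_pderiv)
    ultimately show ?case
      using Suc.prems legendre_primitive_at_end[of k n "-1"] by (simp del: legendre_primitive.simps)
  qed
  from this[of "degree r"] assms show ?thesis by simp
qed

lemma integral_poly_legendre_poly:
  "degree r < n \<Longrightarrow> integral {-1..1} (\<lambda>t. poly r t * poly (legendre_poly n) t) = 0"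
  using integral_poly_legendre_primitive[of r 0 n] by simp

lemma integral_legendre_kernel: "integral {-1..1} (legendre_kernel n x) = 1"
proof -
  have "integral {-1..1} (legendre_kernel n x) =
      (\<Sum>k\<le>n. integral {-1..1} (\<lambda>t. (2 * real k + 1) / 2 * poly (legendre_poly k) x * poly (legendre_poly k) t))"
    unfolding legendre_kernel_def
    by (rule integral_sum) (auto intro!: integrable_continuous_real continuous_intros)
  also have "\<dots> = (\<Sum>k\<le>n. if k = 0 then 1 else 0)"
  proof (rule sum.cong[OF refl])
    fix k
    show "integral {-1..1} (\<lambda>t. (2 * real k + 1) / 2 * poly (legendre_poly k) x * poly (legendre_poly k) t) =
        (if k = 0 then 1 else 0)"
      using integral_poly_legendre_poly[of 1 k] by (cases "k = 0") simp_all
  qed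
  finally show ?thesis by simp
qed

text \<open>Write p(t) = p(x) - (x - t) r(t). The constant p(x) is reproduced because the kernel has
  integral 1, and Christoffel-Darboux turns the rest into integrals of r against P_n and P_(n+1),
  which vanish by orthogonality.\<close>

lemma legendre_kernel_reproduces_poly:
  assumes "degree p \<le> n" "n \<ge> 1"
  shows "integral {-1..1} (\<lambda>t. poly p t * legendre_kernel n x t) = poly p x"
proof -
  define r where "r = synthetic_div p x"
  \<comment> \<open>For constant p the quotient has degree 0, so n \<ge> 1 is used.\<close>
  have r: "degree r < n"
    using assms by (auto simp: r_def degree_synthetic_div)
  have p: "poly p t = poly p x - (x - t) * poly r t" for t
  proof -
    have "poly ([:- x, 1:] * r + [:poly p x:]) t = poly p t"
      unfolding r_def by (subst synthetic_div_correct') simp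
    then show ?thesis by (simp add: algebra_simps)
  qed
  define A B where "A = real (Suc n) / 2 * poly (legendre_poly (Suc n)) x"
    and "B = real (Suc n) / 2 * poly (legendre_poly n) x"
  have eq: "poly p t * legendre_kernel n x t = poly p x * legendre_kernel n x t -
      (A * (poly r t * poly (legendre_poly n) t) - B * (poly r t * poly (legendre_poly (Suc n)) t))" for t
    using christoffel_darboux[of x t n] p[of t] unfolding A_def B_def by algebra
  have "(legendre_kernel n x has_integral 1) {-1..1}"
    "((\<lambda>t. poly r t * poly (legendre_poly n) t) has_integral 0) {-1..1}"
    "((\<lambda>t. poly r t * poly (legendre_poly (Suc n)) t) has_integral 0) {-1..1}"
    using r unfolding has_integral_integrable_integral
    by (auto simp: integral_legendre_kernel integral_poly_legendre_poly
        intro!: integrable_continuous_real continuous_intros)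
  then have "((\<lambda>t. poly p t * legendre_kernel n x t) has_integral
      (poly p x * 1 - (A * 0 - B * 0))) {-1..1}"
    unfolding eq by (intro has_integral_diff has_integral_mult_right)
  then show ?thesis
    by (simp add: integral_unique)
qed

lemma legendre_projection_eq_integral:
  assumes "continuous_on {-1..1} f"
  shows "legendre_projection f n x = integral {-1..1} (\<lambda>t. f t * legendre_kernel n x t)"
proof -
  have "legendre_projection f n x =
      (\<Sum>k\<le>n. integral {-1..1} (\<lambda>t. (2 * real k + 1) / 2 * poly (legendre_poly k) x * (f t * poly (legendre_poly k) t)))"
    unfolding legendre_projection_def legendre_coeff_def
    by (intro sum.cong) simp_all
  also have "\<dots> = integral {-1..1} (\<lambda>t. \<Sum>k\<le>n. (2 * real k + 1) / 2 * poly (legendre_poly k) x * (f t * poly (legendre_poly k) t))"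
    by (rule integral_sum[symmetric]) (auto intro!: integrable_continuous_real continuous_intros assms)
  also have "\<dots> = integral {-1..1} (\<lambda>t. f t * legendre_kernel n x t)"
    by (simp add: legendre_kernel_def sum_distrib_left mult_ac)
  finally show ?thesis .
qed

lemma DERIV_reflect_within:
  assumes "(F has_real_derivative D) (at (- t) within {-1..1})" "\<xi> < 1"
  shows "((\<lambda>t. F (- t)) has_real_derivative - D) (at t within {- \<xi>..1})"
proof -
  have "(F has_real_derivative D) (at (- t) within uminus ` {- \<xi>..1})"
    using assms by (intro has_field_derivative_subset[OF assms(1)]) auto
  moreover have "(uminus has_real_derivative - 1) (at t within {- \<xi>..1})"
    by (auto intro!: derivative_eq_intros)
  ultimately have "(F \<circ> uminus has_real_derivative D * - 1) (at t within {- \<xi>..1})"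
    by (rule DERIV_image_chain)
  then show ?thesis by (simp add: o_def)
qed

theorem mainTheorem5:
  fixes f g :: "real \<Rightarrow> real" and \<xi> \<alpha> x :: real
  assumes "\<xi> \<in> {-1<..<1}"
    and "\<alpha> > 0"
    and "\<nexists>m::nat. \<alpha> = 2 * real m"
    and "smooth_on {-1..1} g"
    and "g \<xi> \<noteq> 0"
    and "\<And>t. t \<in> {-1..1} \<Longrightarrow> f t = \<bar>t - \<xi>\<bar> powr \<alpha> * g t"
    and "x \<in> {-1..1}"
  shows "(\<lambda>n::nat. \<bar>f x - legendre_projection f n x\<bar>) \<in>
           O(\<lambda>n. if x = \<xi> then real n powr (-\<alpha>)
                 else if x = 1 \<or> x = -1 then real n powr (-\<alpha> - 1 / 2)
                 else real n powr (-\<alpha> - 1))"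
proof -
  note \<xi> = assms(1) and \<alpha> = assms(2) and f = assms(6) and x = assms(7)
  obtain G :: "nat \<Rightarrow> real \<Rightarrow> real" where G0: "\<And>t. t \<in> {-1..1} \<Longrightarrow> G 0 t = g t"
    and G: "\<And>k t. t \<in> {-1..1} \<Longrightarrow> (G k has_real_derivative G (Suc k) t) (at t within {-1..1})"
    using assms(4) unfolding smooth_on_def by blast
  define N where "N = nat \<lceil>\<alpha>\<rceil>"
  have N: "\<alpha> \<le> real N" unfolding N_def using \<alpha> by linarith
  \<comment> \<open>Chosen so that p(x) = f(x); for x = \<xi> both sides are 0.\<close>
  define c where "c = (if x = \<xi> then 0 else f x / (x - \<xi>) ^ N)"
  define p where "p = smult c ([:- \<xi>, 1:] ^ N)"
  have poly_p: "poly p t = c * (t - \<xi>) ^ N" for t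
    by (simp add: p_def poly_power)
  have px: "poly p x = f x"
    using x \<alpha> by (auto simp: poly_p c_def f)
  let ?rate = "\<lambda>n::nat. if x = \<xi> then real n powr (-\<alpha>)
                 else if x = 1 \<or> x = -1 then real n powr (-\<alpha> - 1 / 2)
                 else real n powr (-\<alpha> - 1)"
  let ?K = "\<lambda>n. legendre_kernel n x"
  have "continuous_on {-1..1} (G 0)"
    using G DERIV_continuous_on by blast
  then have "continuous_on {-1..1} (\<lambda>t. \<bar>t - \<xi>\<bar> powr \<alpha> * G 0 t)"
    using \<alpha> by (intro continuous_intros continuous_on_powr') auto
  then have contf: "continuous_on {-1..1} f"
    by (rule continuous_on_eq) (simp add: f G0)
  have contq: "continuous_on {a..b} (\<lambda>t. (f t - poly p t) * ?K n t)" if "-1 \<le> a" "b \<le> 1" for a b n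
    using that by (intro continuous_intros continuous_on_subset[OF contf]) auto

  \<comment> \<open>The integral to the right of \<xi>\<close>
  let ?R = "\<lambda>n. integral {\<xi>..1} (\<lambda>t. (f t - poly p t) * ?K n t)"
  have "(\<lambda>n. integral {\<xi>..1} (\<lambda>t. ((t - \<xi>) powr \<alpha> * G 0 t - c * (t - \<xi>) ^ N) * ?K n t)) \<in> O(?rate)"
  proof (rule one_sided_kernel_bound[OF \<xi> \<alpha> N _ x])
    show "(G k has_real_derivative G (Suc k) t) (at t within {\<xi>..1})" if "t \<in> {\<xi>..1}" for k t
      using that \<xi> by (intro has_field_derivative_subset[OF G]) auto
    show "(x - \<xi>) powr \<alpha> * G 0 x = c * (x - \<xi>) ^ N" if "\<xi> < x"
      using that x px by (simp add: poly_p f G0)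
  qed (simp add: c_def)
  moreover have "integral {\<xi>..1} (\<lambda>t. ((t - \<xi>) powr \<alpha> * G 0 t - c * (t - \<xi>) ^ N) * ?K n t) = ?R n" for n
    using \<xi> by (intro integral_cong) (simp add: poly_p f G0)
  ultimately have R: "?R \<in> O(?rate)" by simp

  \<comment> \<open>The integral to the left of \<xi>\<close>
  let ?L = "\<lambda>n. integral {-1..\<xi>} (\<lambda>t. (f t - poly p t) * ?K n t)"
  \<comment> \<open>The derivatives of g(-t). The reflection replaces \<xi> and x by -\<xi> and -x,
    and the coefficient c by c (-1)^N.\<close>
  define G' where "G' = (\<lambda>k t. (-1) ^ k * G k (- t))"
  have "(\<lambda>n. integral {-\<xi>..1} (\<lambda>t. ((t - (-\<xi>)) powr \<alpha> * G' 0 t - (c * (-1) ^ N) * (t - (-\<xi>)) ^ N)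
      * legendre_kernel n (-x) t)) \<in> O(\<lambda>n. if -x = -\<xi> then real n powr (-\<alpha>)
                 else if -x = 1 \<or> -x = -1 then real n powr (-\<alpha> - 1 / 2)
                 else real n powr (-\<alpha> - 1))"
  proof (rule one_sided_kernel_bound[OF _ \<alpha> N])
    show "(G' k has_real_derivative G' (Suc k) t) (at t within {-\<xi>..1})" if "t \<in> {-\<xi>..1}" for k t
    proof -
      have "((\<lambda>t. G k (- t)) has_real_derivative - G (Suc k) (- t)) (at t within {- \<xi>..1})"
        using that \<xi> by (intro DERIV_reflect_within G) auto
      then have "((\<lambda>t. (-1) ^ k * G k (- t)) has_real_derivative (-1) ^ k * - G (Suc k) (- t)) (at t within {- \<xi>..1})"
        by (rule DERIV_cmult)
      then show ?thesis by (simp add: G'_def)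
    qed
    show "(- x - - \<xi>) powr \<alpha> * G' 0 (- x) = c * (-1) ^ N * (- x - - \<xi>) ^ N" if "- \<xi> < - x"
    proof -
      have "(-1) ^ N * (- x - - \<xi>) ^ N = (x - \<xi>) ^ N"
        by (simp flip: power_mult_distrib)
      then have "c * (-1) ^ N * (- x - - \<xi>) ^ N = f x"
        using px by (simp only: poly_p mult.assoc)
      moreover have "\<bar>x - \<xi>\<bar> = - x - - \<xi>"
        using that by simp
      moreover have "G' 0 (- x) = g x"
        using x by (simp add: G'_def G0)
      ultimately show ?thesis
        using f[OF x] by simp
    qed
  qed (use \<xi> x in \<open>auto simp: c_def\<close>)
  moreover have "integral {-\<xi>..1} (\<lambda>t. ((t - (-\<xi>)) powr \<alpha> * G' 0 t - (c * (-1) ^ N) * (t - (-\<xi>)) ^ N)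
      * legendre_kernel n (-x) t) = ?L n" for n
  proof -
    have "integral {-\<xi>..1} (\<lambda>t. ((t - (-\<xi>)) powr \<alpha> * G' 0 t - (c * (-1) ^ N) * (t - (-\<xi>)) ^ N)
      * legendre_kernel n (-x) t) = integral {-\<xi>..1} (\<lambda>t. (f (- t) - poly p (- t)) * ?K n (- t))"
    proof (rule integral_cong)
      fix t assume t: "t \<in> {- \<xi>..1}"
      have "(-1) ^ N * (t - - \<xi>) ^ N = (- t - \<xi>) ^ N"
        by (simp flip: power_mult_distrib)
      then have "c * (-1) ^ N * (t - - \<xi>) ^ N = poly p (- t)"
        by (simp only: poly_p mult.assoc)
      moreover have "\<bar>- t - \<xi>\<bar> = t - - \<xi>"
        using t by simp
      moreover have "G' 0 t = g (- t)" "f (- t) = \<bar>- t - \<xi>\<bar> powr \<alpha> * g (- t)"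
        using t \<xi> by (simp_all add: G'_def G0 f)
      ultimately show "((t - (-\<xi>)) powr \<alpha> * G' 0 t - (c * (-1) ^ N) * (t - (-\<xi>)) ^ N) * legendre_kernel n (-x) t
          = (f (- t) - poly p (- t)) * ?K n (- t)"
        by (simp only: legendre_kernel_minus)
    qed
    also have "\<dots> = integral {-\<xi>..- (-1)} (\<lambda>t. (f (- t) - poly p (- t)) * ?K n (- t))"
      by simp
    also have "\<dots> = ?L n"
      by (rule Henstock_Kurzweil_Integration.integral_reflect_real)
    finally show ?thesis .
  qed
  moreover have "(- x = - \<xi>) = (x = \<xi>)" "(- x = 1 \<or> - x = -1) = (x = 1 \<or> x = -1)"
    by auto
  ultimately have L: "?L \<in> O(?rate)" by (simp only:)

  \<comment> \<open>Assembling the error\<close>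
  have "\<forall>\<^sub>F n in sequentially. ?L n + ?R n = - (f x - legendre_projection f n x)"
    using eventually_ge_at_top[of "max 1 (degree p)"]
  proof eventually_elim
    case (elim n)
    have "?L n + ?R n = integral {-1..1} (\<lambda>t. (f t - poly p t) * ?K n t)"
      using \<xi> by (intro Henstock_Kurzweil_Integration.integral_combine integrable_continuous_real contq) auto
    also have "\<dots> = integral {-1..1} (\<lambda>t. f t * ?K n t) - integral {-1..1} (\<lambda>t. poly p t * ?K n t)"
      unfolding left_diff_distrib
      by (intro integral_diff integrable_continuous_real continuous_intros contf)
    \<comment> \<open>As n is at least the degree of p, the integral of p against the kernel is p(x)
      = f(x).\<close>
    also have "\<dots> = legendre_projection f n x - f x"
      using elim by (simp add: legendre_projection_eq_integral[OF contf] legendre_kernel_reproduces_poly px)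
    finally show ?case by simp
  qed
  moreover have "(\<lambda>n. ?L n + ?R n) \<in> O(?rate)"
    by (rule sum_in_bigo[OF L R])
  ultimately have "(\<lambda>n. - (f x - legendre_projection f n x)) \<in> O(?rate)"
    using landau_o.big.in_cong by fast
  then have "(\<lambda>n. f x - legendre_projection f n x) \<in> O(?rate)"
    by (simp only: landau_o.big.uminus_in_iff)
  then show ?thesis by simp
qed

end
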